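(* Let $\Gamma$ be a closed curve in $\mathbb R^3$ of class $C^{1,\alpha}$ for some $\alpha\in(0,1)$. Then $$2\pi\,\mathcal H^1(\Gamma)\le\mathcal E_1(\Gamma),$$ with equality only if $\Gamma$ is a planar, convex curve.
   Context: Closed curves are understood to be embedded, so that $\Gamma$ has a tangent line $T_x\Gamma$ (as a linear subspace) at every $x\in\Gamma$. For distinct $x,y\in\Gamma$ the tangent-point radius is $$R_{tp}(x,y):=\frac{|x-y|^2}{2\,\mathrm{dist}(x-y,T_x\Gamma)}\in(0,\infty]$$ (so $1/R_{tp}(x,y)=0$ if $x-y\in T_x\Gamma$). The $L^1$-tangent-point energy is $$\mathcal E_1(\Gamma):=\int_\Gamma\int_\Gamma\frac1{R_{tp}(x,y)}\,d\mathcal H^1(x)\,d\mathcal H^1(y)\in[0,\infty].$$ *)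

theory Defs
  imports "HOL-Analysis.Analysis"
begin

section \<open>One-dimensional Hausdorff measure\<close>

text \<open>
  The countable covers are indexed by \<open>nat\<close>; finite covers are included, because empty sets may be
  used for padding (\<open>diameter {} = 0\<close>). Boundedness of the covering sets has to be required
  explicitly, since \<open>diameter\<close> carries no information on unbounded sets. In dimension one the usual
  normalisation constant of the Hausdorff measure is \<open>1\<close>.
\<close>

definition hausdorff_pre :: "real \<Rightarrow> 'a::metric_space set \<Rightarrow> ennreal" where
  "hausdorff_pre \<delta> A =
     (INF U \<in> {U :: nat \<Rightarrow> 'a set. A \<subseteq> (\<Union>i. U i) \<and> (\<forall>i. bounded (U i) \<and> diameter (U i) \<le> \<delta>)}.
        \<Sum>i. ennreal (diameter (U i)))"

definition hausdorff_outer :: "'a::metric_space set \<Rightarrow> ennreal" where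
  "hausdorff_outer A = (SUP \<delta>\<in>{0<..}. hausdorff_pre \<delta> A)"

text \<open>
  \<open>measure_of\<close> yields the null measure unless the given set function is countably additive on the
  generated sigma algebra; that it is on Borel sets is \<open>emeasure_hausdorff1\<close> below.
\<close>

definition hausdorff1 :: "'a::metric_space measure" where
  "hausdorff1 = measure_of UNIV (sets borel) hausdorff_outer"

lemma space_hausdorff1 [simp]: "space hausdorff1 = UNIV"
  by (simp add: hausdorff1_def)

lemma sets_hausdorff1 [simp, measurable_cong]: "sets hausdorff1 = sets borel"
  by (simp add: hausdorff1_def sets.sigma_sets_eq[of borel, simplified])

lemma hausdorff_pre_empty: "\<delta> \<ge> 0 \<Longrightarrow> hausdorff_pre \<delta> {} = 0"
  unfolding hausdorff_pre_def
  by (intro antisym INF_lower2[of "\<lambda>_. {}"]) auto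

lemma hausdorff_pre_mono: "A \<subseteq> B \<Longrightarrow> hausdorff_pre \<delta> A \<le> hausdorff_pre \<delta> B"
  unfolding hausdorff_pre_def by (intro INF_superset_mono) auto

lemma hausdorff_pre_antimono: "\<delta> \<le> \<epsilon> \<Longrightarrow> hausdorff_pre \<epsilon> A \<le> hausdorff_pre \<delta> A"
  unfolding hausdorff_pre_def by (intro INF_superset_mono) (auto intro: order_trans)

lemma hausdorff_pre_le_outer: "\<delta> > 0 \<Longrightarrow> hausdorff_pre \<delta> A \<le> hausdorff_outer A"
  unfolding hausdorff_outer_def by (intro SUP_upper) auto

lemma hausdorff_pre_countably_subadditive:
  "hausdorff_pre \<delta> (\<Union>i. A i) \<le> (\<Sum>i. hausdorff_pre \<delta> (A i))"
proof (rule ennreal_le_epsilon)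
  fix e :: real assume e: "0 < e" and fin: "(\<Sum>n. hausdorff_pre \<delta> (A n)) < top"
  have less: "hausdorff_pre \<delta> (A n) < hausdorff_pre \<delta> (A n) + e * (1/2)^Suc n" for n
    using e fin by (auto simp add: less_top dest!: ennreal_suminf_lessD)
  have "\<exists>U. A n \<subseteq> (\<Union>i. U i) \<and> (\<forall>i. bounded (U i) \<and> diameter (U i) \<le> \<delta>) \<and>
          (\<Sum>i. ennreal (diameter (U i))) < hausdorff_pre \<delta> (A n) + e * (1/2)^Suc n" for n
    using less[of n] unfolding hausdorff_pre_def[of \<delta> "A n"] INF_less_iff by auto
  then obtain B where sub: "\<And>n. A n \<subseteq> (\<Union>i. B n i)"
    and B: "\<And>n i. bounded (B n i)" "\<And>n i. diameter (B n i) \<le> \<delta>"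
    and le: "\<And>n. (\<Sum>i. ennreal (diameter (B n i))) < hausdorff_pre \<delta> (A n) + e * (1/2)^Suc n"
    by metis
  define C where "C = case_prod B o prod_decode"
  have cov: "(\<Union>i. A i) \<subseteq> (\<Union>i. C i)"
    using sub by (auto simp add: C_def subset_eq) (metis prod.case prod_encode_inverse)
  have "hausdorff_pre \<delta> (\<Union>i. A i) \<le> (\<Sum>i. ennreal (diameter (C i)))"
    unfolding hausdorff_pre_def
    by (intro INF_lower) (use cov B in \<open>auto simp: C_def split_def\<close>)
  also have "\<dots> = (\<Sum>n. \<Sum>i. ennreal (diameter (B n i)))"
    unfolding C_def comp_def
    by (subst suminf_ennreal_2dimen[where f="\<lambda>p. ennreal (diameter (case_prod B p))", symmetric]) auto
  also have "\<dots> \<le> (\<Sum>n. hausdorff_pre \<delta> (A n) + e * (1/2) ^ Suc n)"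
    by (intro suminf_le less_imp_le le summableI)
  also have "\<dots> = (\<Sum>n. hausdorff_pre \<delta> (A n)) + (\<Sum>n. ennreal e * ennreal ((1/2) ^ Suc n))"
    using \<open>0 < e\<close> by (subst suminf_add[symmetric])
                     (auto simp del: ennreal_suminf_cmult simp add: ennreal_mult[symmetric])
  also have "\<dots> = (\<Sum>n. hausdorff_pre \<delta> (A n)) + e"
    unfolding ennreal_suminf_cmult
    by (subst suminf_ennreal_eq[OF zero_le_power power_half_series]) auto
  finally show "hausdorff_pre \<delta> (\<Union>i. A i) \<le> (\<Sum>n. hausdorff_pre \<delta> (A n)) + e" .
qed

lemma hausdorff_outer_empty: "hausdorff_outer {} = 0"
proof -
  have "hausdorff_outer ({} :: 'a set) \<le> 0"
    unfolding hausdorff_outer_def by (intro SUP_least) (simp add: hausdorff_pre_empty)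
  then show ?thesis by simp
qed

lemma hausdorff_outer_mono: "A \<subseteq> B \<Longrightarrow> hausdorff_outer A \<le> hausdorff_outer B"
  unfolding hausdorff_outer_def by (intro SUP_mono) (auto intro: hausdorff_pre_mono)

lemma hausdorff_outer_countably_subadditive:
  "hausdorff_outer (\<Union>i. A i) \<le> (\<Sum>i. hausdorff_outer (A i))"
  unfolding hausdorff_outer_def[of "\<Union>i. A i"]
proof (intro SUP_least)
  fix \<delta> :: real assume "\<delta> \<in> {0<..}"
  then have "(\<Sum>i. hausdorff_pre \<delta> (A i)) \<le> (\<Sum>i. hausdorff_outer (A i))"
    by (intro suminf_le hausdorff_pre_le_outer summableI) auto
  then show "hausdorff_pre \<delta> (\<Union>i. A i) \<le> (\<Sum>i. hausdorff_outer (A i))"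
    using hausdorff_pre_countably_subadditive order_trans by blast
qed

lemma outer_measure_space_hausdorff_outer: "outer_measure_space (Pow UNIV) hausdorff_outer"
  unfolding outer_measure_space_def positive_def increasing_def countably_subadditive_def
  by (auto simp: hausdorff_outer_empty intro: hausdorff_outer_mono
      hausdorff_outer_countably_subadditive)

lemma hausdorff_outer_Un: "hausdorff_outer (A \<union> B) \<le> hausdorff_outer A + hausdorff_outer B"
proof -
  have "subadditive (Pow UNIV) (hausdorff_outer :: 'a set \<Rightarrow> ennreal)"
    using outer_measure_space_hausdorff_outer
    by (intro ring_of_sets.countably_subadditive_subadditive[OF ring_of_sets_Pow])
       (auto simp: outer_measure_space_def)
  from subadditiveD[OF this, of A "B - A"] have
    "hausdorff_outer (A \<union> B) \<le> hausdorff_outer A + hausdorff_outer (B - A)"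
    by (auto simp: Un_Diff_cancel)
  also have "\<dots> \<le> hausdorff_outer A + hausdorff_outer B"
    by (intro add_left_mono hausdorff_outer_mono) auto
  finally show ?thesis .
qed

lemma hausdorff_pre_separated:
  assumes sep: "\<And>x y. x \<in> A \<Longrightarrow> y \<in> B \<Longrightarrow> \<delta> < dist x y" and "\<delta> \<ge> 0"
  shows "hausdorff_pre \<delta> A + hausdorff_pre \<delta> B \<le> hausdorff_pre \<delta> (A \<union> B)"
  unfolding hausdorff_pre_def[of \<delta> "A \<union> B"]
proof (intro INF_greatest, clarify)
  fix U :: "nat \<Rightarrow> 'a set"
  assume cov: "A \<union> B \<subseteq> (\<Union>i. U i)" and U: "\<forall>i. bounded (U i) \<and> diameter (U i) \<le> \<delta>"
  define V where "V = (\<lambda>i. if U i \<inter> A = {} then {} else U i)"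
  define W where "W = (\<lambda>i. if U i \<inter> B = {} then {} else U i)"
  have one: "V i = {} \<or> W i = {}" for i
  proof (rule ccontr)
    assume "\<not> ?thesis"
    then obtain x y where xy: "x \<in> U i" "x \<in> A" "y \<in> U i" "y \<in> B"
      by (auto simp: V_def W_def split: if_splits)
    then have "dist x y \<le> \<delta>"
      using U diameter_bounded_bound[of "U i" x y] by (meson order_trans)
    with sep[of x y] xy show False by auto
  qed
  have "hausdorff_pre \<delta> A \<le> (\<Sum>i. ennreal (diameter (V i)))"
    unfolding hausdorff_pre_def
    by (intro INF_lower) (use cov U \<open>\<delta> \<ge> 0\<close> in \<open>fastforce simp: V_def\<close>)
  moreover have "hausdorff_pre \<delta> B \<le> (\<Sum>i. ennreal (diameter (W i)))"
    unfolding hausdorff_pre_def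
    by (intro INF_lower) (use cov U \<open>\<delta> \<ge> 0\<close> in \<open>fastforce simp: W_def\<close>)
  ultimately have "hausdorff_pre \<delta> A + hausdorff_pre \<delta> B \<le>
      (\<Sum>i. ennreal (diameter (V i))) + (\<Sum>i. ennreal (diameter (W i)))"
    by (rule add_mono)
  also have "\<dots> = (\<Sum>i. ennreal (diameter (V i)) + ennreal (diameter (W i)))"
    by (intro suminf_add summableI)
  also have "\<dots> \<le> (\<Sum>i. ennreal (diameter (U i)))"
  proof (intro suminf_le summableI)
    show "ennreal (diameter (V i)) + ennreal (diameter (W i)) \<le> ennreal (diameter (U i))" for i
      using one[of i] by (auto simp: V_def W_def split: if_splits)
  qed
  finally show "hausdorff_pre \<delta> A + hausdorff_pre \<delta> B \<le> (\<Sum>i. ennreal (diameter (U i)))" .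
qed

lemma hausdorff_outer_separated:
  assumes sep: "\<And>x y. x \<in> A \<Longrightarrow> y \<in> B \<Longrightarrow> r < dist x y" and r: "r > 0"
  shows "hausdorff_outer A + hausdorff_outer B \<le> hausdorff_outer (A \<union> B)"
proof -
  have *: "hausdorff_pre \<delta> A + hausdorff_pre \<epsilon> B \<le> hausdorff_outer (A \<union> B)"
    if "\<delta> > 0" "\<epsilon> > 0" for \<delta> \<epsilon>
  proof -
    define m where "m = min r (min \<delta> \<epsilon>)"
    have m: "m > 0" "m \<le> r" "m \<le> \<delta>" "m \<le> \<epsilon>"
      using that r by (auto simp: m_def)
    have "hausdorff_pre \<delta> A + hausdorff_pre \<epsilon> B \<le> hausdorff_pre m A + hausdorff_pre m B"
      by (intro add_mono hausdorff_pre_antimono m)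
    also have "\<dots> \<le> hausdorff_pre m (A \<union> B)"
      using m sep by (intro hausdorff_pre_separated) (auto intro: le_less_trans)
    also have "\<dots> \<le> hausdorff_outer (A \<union> B)"
      using m by (intro hausdorff_pre_le_outer)
    finally show ?thesis .
  qed
  have ne: "{0::real<..} \<noteq> {}" by (auto intro: gt_ex)
  have "hausdorff_outer A + hausdorff_outer B = (SUP \<delta>\<in>{0<..}. hausdorff_pre \<delta> A + hausdorff_outer B)"
    unfolding hausdorff_outer_def[of A] by (rule ennreal_SUP_add_left[OF ne, symmetric])
  also have "\<dots> = (SUP \<delta>\<in>{0<..}. SUP \<epsilon>\<in>{0<..}. hausdorff_pre \<delta> A + hausdorff_pre \<epsilon> B)"
    unfolding hausdorff_outer_def[of B]
    by (intro SUP_cong refl ennreal_SUP_add_right[OF ne])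
  also have "\<dots> \<le> hausdorff_outer (A \<union> B)"
    by (intro SUP_least) (auto intro: *)
  finally show ?thesis .
qed

lemma hausdorff_outer_layers:
  fixes R :: "nat \<Rightarrow> 'a::metric_space set"
  assumes sep: "\<And>j k. j + 2 \<le> k \<Longrightarrow> \<exists>r>0. \<forall>x\<in>R j. \<forall>y\<in>R k. r < dist x y"
    and sub: "\<And>k. R k \<subseteq> T"
  shows "(\<Sum>k. hausdorff_outer (R k)) \<le> 2 * hausdorff_outer T"
proof -
  have part: "(\<Sum>k<n. hausdorff_outer (R (2 * k + p))) \<le> hausdorff_outer (\<Union>k<n. R (2 * k + p))" for n p
  proof (induction n)
    case (Suc n)
    have "\<exists>r>0. \<forall>x\<in>(\<Union>k<m. R (2 * k + p)). \<forall>y\<in>R (2 * n + p). r < dist x y" if "m \<le> n" for m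
      using that
    proof (induction m)
      case 0 then show ?case by (auto intro: exI[of _ 1])
    next
      case (Suc m)
      then obtain r where "r > 0" "\<forall>x\<in>(\<Union>k<m. R (2 * k + p)). \<forall>y\<in>R (2 * n + p). r < dist x y"
        by auto
      moreover obtain s where "s > 0" "\<forall>x\<in>R (2 * m + p). \<forall>y\<in>R (2 * n + p). s < dist x y"
        using sep[of "2 * m + p" "2 * n + p"] Suc.prems by auto
      ultimately show ?case
        by (intro exI[of _ "min r s"]) (auto simp: lessThan_Suc min_less_iff_disj)
    qed
    then obtain r where r: "r > 0"
      "\<forall>x\<in>(\<Union>k<n. R (2 * k + p)). \<forall>y\<in>R (2 * n + p). r < dist x y" by blast
    have "(\<Sum>k<Suc n. hausdorff_outer (R (2 * k + p))) \<le>
        hausdorff_outer (\<Union>k<n. R (2 * k + p)) + hausdorff_outer (R (2 * n + p))"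
      using Suc.IH by (simp add: add_right_mono)
    also have "\<dots> \<le> hausdorff_outer ((\<Union>k<n. R (2 * k + p)) \<union> R (2 * n + p))"
      by (rule hausdorff_outer_separated[OF _ r(1)]) (use r(2) in blast)
    also have "(\<Union>k<n. R (2 * k + p)) \<union> R (2 * n + p) = (\<Union>k<Suc n. R (2 * k + p))"
      by (auto simp: lessThan_Suc)
    finally show ?case .
  qed simp
  have part': "(\<Sum>k<n. hausdorff_outer (R (2 * k + p))) \<le> hausdorff_outer T" for n p
    by (rule order_trans[OF part]) (use sub in \<open>auto intro!: hausdorff_outer_mono\<close>)
  have "(\<Sum>k<n. hausdorff_outer (R k)) \<le> 2 * hausdorff_outer T" for n
  proof -
    have eq: "(\<Sum>k<2*n. hausdorff_outer (R k)) =
        (\<Sum>k<n. hausdorff_outer (R (2 * k + 0))) + (\<Sum>k<n. hausdorff_outer (R (2 * k + 1)))"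
      by (induction n) (auto simp: algebra_simps)
    have "(\<Sum>k<n. hausdorff_outer (R k)) \<le> (\<Sum>k<2*n. hausdorff_outer (R k))"
      by (intro sum_mono2) auto
    also have "\<dots> \<le> hausdorff_outer T + hausdorff_outer T"
      unfolding eq by (intro add_mono part')
    finally show ?thesis by (simp add: mult_2)
  qed
  then show ?thesis by (intro suminf_le_const summableI)
qed

lemma closed_hausdorff_outer_split:
  fixes F :: "'a::metric_space set"
  assumes F: "closed F"
  shows "hausdorff_outer (T \<inter> F) + hausdorff_outer (T - F) \<le> hausdorff_outer T"
proof (cases "F = {} \<or> hausdorff_outer T = top")
  case True
  then show ?thesis by (auto simp: hausdorff_outer_empty)
next
  case False
  then have ne: "F \<noteq> {}" and fin: "hausdorff_outer T < top" by (auto simp: less_top)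
  define D where "D = (\<lambda>n::nat. {x\<in>T. 1 / real (Suc n) \<le> infdist x F})"
  define R where "R = (\<lambda>n. D (Suc n) - D n)"
  have Dmono: "D m \<subseteq> D n" if "m \<le> n" for m n
  proof -
    have "1 / real (Suc n) \<le> 1 / real (Suc m)" using that by (intro divide_left_mono) auto
    then show ?thesis unfolding D_def using order_trans by blast
  qed
  have TF: "T - F \<subseteq> D n \<union> (\<Union>k. R (k + n))" for n
  proof
    fix x assume x: "x \<in> T - F"
    then have "infdist x F > 0"
      using F ne by (metis DiffD2 infdist_pos_not_in_closed)
    then obtain N where "1 / real (Suc N) < infdist x F"
      using nat_approx_posE by blast
    then have xN: "x \<in> D N" using x by (auto simp: D_def)
    show "x \<in> D n \<union> (\<Union>k. R (k + n))"
    proof (cases "x \<in> D n")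
      case False
      define m where "m = (LEAST m. x \<in> D m)"
      have m: "x \<in> D m" "\<And>j. j < m \<Longrightarrow> x \<notin> D j"
        unfolding m_def using xN by (auto intro: LeastI dest: not_less_Least)
      have "n < m" using m(1) False Dmono[of m n] by (meson not_le subsetD)
      then obtain k where "m = Suc (k + n)"
        by (metis add.commute less_imp_Suc_add)
      with m have "x \<in> R (k + n)" by (auto simp: R_def)
      then show ?thesis by auto
    qed auto
  qed
  have "(\<Sum>k. hausdorff_outer (R k)) \<le> 2 * hausdorff_outer T"
  proof (rule hausdorff_outer_layers)
    show "R k \<subseteq> T" for k by (auto simp: R_def D_def)
    fix j k :: nat assume jk: "j + 2 \<le> k"
    define a b where "a = 1 / real (j + 2)" and "b = 1 / real (j + 3)"
    have "b < a" unfolding a_def b_def by (intro divide_strict_left_mono) auto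
    define r where "r = (a - b) / 2"
    have r: "r > 0" using \<open>b < a\<close> by (simp add: r_def)
    have "r < dist x y" if xy: "x \<in> R j" "y \<in> R k" for x y
    proof -
      have "x \<in> D (Suc j)" "y \<in> T" "y \<notin> D k"
        using xy unfolding R_def D_def by blast+
      then have "a \<le> infdist x F" and y: "infdist y F < 1 / real (Suc k)"
        unfolding D_def a_def by auto
      moreover have "1 / real (Suc k) \<le> b"
        unfolding b_def using jk by (intro divide_left_mono) auto
      with y have "infdist y F < b" by (rule less_le_trans)
      moreover have "infdist x F \<le> infdist y F + dist x y"
        by (rule infdist_triangle)
      ultimately have "2 * r < dist x y" unfolding r_def by argo
      with r show ?thesis by linarith
    qed
    with r show "\<exists>r>0. \<forall>x\<in>R j. \<forall>y\<in>R k. r < dist x y" by blast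
  qed
  also have "\<dots> < top" using fin by (simp add: ennreal_mult_less_top)
  finally have sumfin: "(\<Sum>k. hausdorff_outer (R k)) \<noteq> top" by simp
  have tail: "(\<lambda>n. \<Sum>k. hausdorff_outer (R (k + n))) \<longlonglongrightarrow> 0"
  proof -
    define g where "g = (\<lambda>k. enn2real (hausdorff_outer (R k)))"
    have g: "hausdorff_outer (R k) = ennreal (g k)" for k
      using ennreal_suminf_lessD[of "\<lambda>k. hausdorff_outer (R k)" top k] sumfin
      by (simp add: g_def less_top)
    have g0: "g k \<ge> 0" for k by (simp add: g_def)
    have sg: "summable g"
      using sumfin g0 by (intro summable_suminf_not_top) (auto simp: g)
    have "(\<lambda>n. \<Sum>k. g (k + n)) \<longlonglongrightarrow> 0"
      using suminf_exist_split2[OF sg] .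
    then have "(\<lambda>n. ennreal (\<Sum>k. g (k + n))) \<longlonglongrightarrow> ennreal 0"
      by (rule tendsto_ennrealI)
    moreover have "ennreal (\<Sum>k. g (k + n)) = (\<Sum>k. hausdorff_outer (R (k + n)))" for n
      unfolding g using sg g0 by (subst suminf_ennreal2) (auto simp: summable_iff_shift)
    ultimately show ?thesis by simp
  qed
  have bound: "hausdorff_outer (T \<inter> F) + hausdorff_outer (T - F) \<le>
      hausdorff_outer T + (\<Sum>k. hausdorff_outer (R (k + n)))" for n
  proof -
    have "hausdorff_outer (T - F) \<le> hausdorff_outer (D n \<union> (\<Union>k. R (k + n)))"
      by (rule hausdorff_outer_mono[OF TF])
    also have "\<dots> \<le> hausdorff_outer (D n) + (\<Sum>k. hausdorff_outer (R (k + n)))"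
      by (rule order_trans[OF hausdorff_outer_Un])
         (intro add_left_mono hausdorff_outer_countably_subadditive)
    finally have "hausdorff_outer (T \<inter> F) + hausdorff_outer (T - F) \<le>
        (hausdorff_outer (T \<inter> F) + hausdorff_outer (D n)) + (\<Sum>k. hausdorff_outer (R (k + n)))"
      by (simp add: add_left_mono add.assoc)
    also have "hausdorff_outer (T \<inter> F) + hausdorff_outer (D n) \<le> hausdorff_outer ((T \<inter> F) \<union> D n)"
    proof (rule hausdorff_outer_separated[where r = "1 / (2 * real (Suc n))"])
      fix x y assume "x \<in> T \<inter> F" "y \<in> D n"
      then have "1 / real (Suc n) \<le> dist x y"
        using infdist_le[of x F y] by (auto simp: D_def dist_commute)
      then show "1 / (2 * real (Suc n)) < dist x y"
        by (rule less_le_trans[rotated]) (simp add: field_simps)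
    qed simp
    also have "hausdorff_outer ((T \<inter> F) \<union> D n) \<le> hausdorff_outer T"
      by (intro hausdorff_outer_mono) (auto simp: D_def)
    finally show ?thesis by (simp add: add_right_mono)
  qed
  have "(\<lambda>n. hausdorff_outer T + (\<Sum>k. hausdorff_outer (R (k + n)))) \<longlonglongrightarrow> hausdorff_outer T + 0"
    by (intro tendsto_add tendsto_const tail)
  then show ?thesis
    using bound by (intro LIMSEQ_le_const) auto
qed

lemma borel_subset_lambda_system_hausdorff:
  "sets borel \<subseteq> lambda_system UNIV (Pow UNIV) (hausdorff_outer :: 'a::metric_space set \<Rightarrow> ennreal)"
proof -
  let ?L = "lambda_system UNIV (Pow UNIV) (hausdorff_outer :: 'a set \<Rightarrow> ennreal)"
  interpret P: sigma_algebra "UNIV :: 'a set" "Pow UNIV" by (rule sigma_algebra_Pow)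
  have ms: "measure_space UNIV ?L hausdorff_outer"
    by (rule P.caratheodory_lemma[OF outer_measure_space_hausdorff_outer])
  then interpret L: sigma_algebra UNIV ?L by (simp add: measure_space_def)
  have closed: "F \<in> ?L" if "closed F" for F :: "'a set"
  proof -
    have "hausdorff_outer (T \<inter> F) + hausdorff_outer (T - F) = hausdorff_outer T" for T
      using closed_hausdorff_outer_split[OF that, of T] hausdorff_outer_Un[of "T \<inter> F" "T - F"]
      by (simp add: Int_Diff_Un antisym)
    then show ?thesis unfolding P.lambda_system_eq by blast
  qed
  have "{S. open S} \<subseteq> ?L"
  proof safe
    fix S :: "'a set" assume "open S"
    then have "UNIV - (- S) \<in> ?L" by (intro L.compl_sets closed) auto
    then show "S \<in> ?L" by (simp add: Compl_eq_Diff_UNIV[symmetric])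
  qed
  then show ?thesis
    unfolding sets_borel by (rule L.sigma_sets_subset)
qed

theorem emeasure_hausdorff1:
  assumes "A \<in> sets borel"
  shows "emeasure hausdorff1 A = hausdorff_outer A"
proof -
  interpret P: sigma_algebra "UNIV :: 'a set" "Pow UNIV" by (rule sigma_algebra_Pow)
  have "measure_space UNIV (sets borel) (hausdorff_outer :: 'a set \<Rightarrow> ennreal)"
    by (rule measure_down[OF P.caratheodory_lemma[OF outer_measure_space_hausdorff_outer]
          sets.sigma_algebra_axioms[of "borel :: 'a measure", unfolded space_borel]
          borel_subset_lambda_system_hausdorff])
  with assms show ?thesis
    unfolding hausdorff1_def
    by (intro emeasure_measure_of_sigma) (auto simp: measure_space_def)
qed


section \<open>Closed curves of class $C^{1,\alpha}$\<close>

text \<open>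
  A curve is a point set. It is closed, embedded and of class $C^{1,\alpha}$ if it is the image of a
  regular \<open>1\<close>-periodic parametrisation that is injective on a period and whose derivative is
  Hoelder continuous with exponent \<open>\<alpha>\<close>.
\<close>

definition C1_holder_closed_param :: "real \<Rightarrow> (real \<Rightarrow> 'a::real_normed_vector) \<Rightarrow> (real \<Rightarrow> 'a) \<Rightarrow> bool"
  where "C1_holder_closed_param \<alpha> \<gamma> \<gamma>' \<longleftrightarrow>
     (\<forall>t. \<gamma> (t + 1) = \<gamma> t) \<and>
     inj_on \<gamma> {0..<1} \<and>
     (\<forall>t. (\<gamma> has_vector_derivative \<gamma>' t) (at t) \<and> \<gamma>' t \<noteq> 0) \<and>
     (\<exists>C. \<forall>s t. norm (\<gamma>' s - \<gamma>' t) \<le> C * \<bar>s - t\<bar> powr \<alpha>)"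

definition C1_holder_closed_curve :: "real \<Rightarrow> 'a::real_normed_vector set \<Rightarrow> bool" where
  "C1_holder_closed_curve \<alpha> \<Gamma> \<longleftrightarrow> (\<exists>\<gamma> \<gamma>'. C1_holder_closed_param \<alpha> \<gamma> \<gamma>' \<and> \<Gamma> = range \<gamma>)"

text \<open>
  The velocities at \<open>x\<close> of curves running in \<open>\<Gamma>\<close> through \<open>x\<close>. For the curves above this is the
  line spanned by the derivative of the parametrisation, see \<open>tangent_line_param\<close>.
\<close>

definition tangent_line :: "'a::real_normed_vector set \<Rightarrow> 'a \<Rightarrow> 'a set" where
  "tangent_line \<Gamma> x =
     {v. \<exists>c \<epsilon>. \<epsilon> > 0 \<and> c 0 = x \<and> (\<forall>t. \<bar>t\<bar> < \<epsilon> \<longrightarrow> c t \<in> \<Gamma>) \<and> (c has_vector_derivative v) (at (0::real))}"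


lemma difference_quotient_tendsto:
  assumes "(f has_vector_derivative D) (at x)"
  shows "((\<lambda>r. (1 / (r - x)) *\<^sub>R (f r - f x)) \<longlongrightarrow> D) (at x)"
proof -
  have "((\<lambda>r. norm (f r - f x - (r - x) *\<^sub>R D) / norm (r - x)) \<longlongrightarrow> 0) (at x)"
    using assms by (simp add: has_vector_derivative_def has_derivative_iff_norm)
  moreover have "\<forall>\<^sub>F r in at x. norm (f r - f x - (r - x) *\<^sub>R D) / norm (r - x) =
      norm ((1 / (r - x)) *\<^sub>R (f r - f x) - D)"
  proof (rule eventually_at_filter[THEN iffD2], intro always_eventually allI impI)
    fix r assume "r \<noteq> x"
    then have "(1 / (r - x)) *\<^sub>R (f r - f x) - D = (1 / (r - x)) *\<^sub>R (f r - f x - (r - x) *\<^sub>R D)"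
      by (simp add: scaleR_diff_right)
    then show "norm (f r - f x - (r - x) *\<^sub>R D) / norm (r - x) =
        norm ((1 / (r - x)) *\<^sub>R (f r - f x) - D)"
      by (simp only: norm_scaleR) simp
  qed
  ultimately have "((\<lambda>r. norm ((1 / (r - x)) *\<^sub>R (f r - f x) - D)) \<longlongrightarrow> 0) (at x)"
    by (rule Lim_transform_eventually)
  then show ?thesis by (simp add: tendsto_norm_zero_iff LIM_zero_iff)
qed

lemma tangent_line_param:
  fixes \<gamma> :: "real \<Rightarrow> 'a::real_inner"
  assumes "C1_holder_closed_param \<alpha> \<gamma> \<gamma>'"
  shows "tangent_line (range \<gamma>) (\<gamma> t) = span {\<gamma>' t}"
proof
  have per: "\<gamma> (u + 1) = \<gamma> u" and inj: "inj_on \<gamma> {0..<1}"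
    and der: "(\<gamma> has_vector_derivative \<gamma>' u) (at u)" and nz: "\<gamma>' u \<noteq> 0" for u
    using assms by (auto simp: C1_holder_closed_param_def)
  have per_nat: "\<gamma> (u + real n) = \<gamma> u" for u n
  proof (induction n)
    case (Suc n)
    then show ?case using per[of "u + real n"] by (simp add: add_ac)
  qed simp
  have per_int: "\<gamma> (u + of_int k) = \<gamma> u" for u k
  proof (cases "k \<ge> 0")
    case True
    then show ?thesis using per_nat[of u "nat k"] by simp
  next
    case False
    then show ?thesis using per_nat[of "u + of_int k" "nat (- k)"] by simp
  qed
  have cont: "continuous_on A \<gamma>" for A
    using der by (intro continuous_at_imp_continuous_on) (auto intro: has_vector_derivative_continuous)
  show "span {\<gamma>' t} \<subseteq> tangent_line (range \<gamma>) (\<gamma> t)"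
  proof
    fix v assume "v \<in> span {\<gamma>' t}"
    then obtain a where v: "v = a *\<^sub>R \<gamma>' t" by (auto simp: span_singleton)
    have "((\<gamma> \<circ> (\<lambda>s. t + a * s)) has_vector_derivative a *\<^sub>R \<gamma>' t) (at 0)"
      by (rule vector_diff_chain_at) (auto intro!: derivative_eq_intros der)
    then show "v \<in> tangent_line (range \<gamma>) (\<gamma> t)"
      unfolding tangent_line_def v
      by (auto intro!: exI[of _ "\<gamma> \<circ> (\<lambda>s. t + a * s)"] exI[of _ 1])
  qed
  show "tangent_line (range \<gamma>) (\<gamma> t) \<subseteq> span {\<gamma>' t}"
  proof
    fix v assume "v \<in> tangent_line (range \<gamma>) (\<gamma> t)"
    then obtain c \<epsilon> where \<epsilon>: "\<epsilon> > 0" and c0: "c 0 = \<gamma> t" and c: "\<And>s. \<bar>s\<bar> < \<epsilon> \<Longrightarrow> c s \<in> range \<gamma>"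
      and cder: "(c has_vector_derivative v) (at (0::real))"
      by (auto simp: tangent_line_def)
    define I where "I = {t - 1/2..t + 1/2}"
    have "\<exists>u\<in>I. \<gamma> u = c s" if s: "\<bar>s\<bar> < \<epsilon>" for s
    proof -
      obtain w where w: "c s = \<gamma> w" using c[OF s] by auto
      define k where "k = \<lfloor>t + 1/2 - w\<rfloor>"
      have "w + of_int k \<in> I" unfolding I_def k_def by (simp; linarith)
      then show ?thesis using w per_int[of w k] by auto
    qed
    then obtain \<tau> where \<tau>: "\<And>s. \<bar>s\<bar> < \<epsilon> \<Longrightarrow> \<tau> s \<in> I \<and> \<gamma> (\<tau> s) = c s" by metis
    have uniq: "u = t" if "u \<in> I" "\<gamma> u = \<gamma> t" for u
    proof -
      have "frac u = frac t"
      proof (rule inj_onD[OF inj])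
        show "\<gamma> (frac u) = \<gamma> (frac t)"
          using that per_int[of u "- \<lfloor>u\<rfloor>"] per_int[of t "- \<lfloor>t\<rfloor>"] by (simp add: frac_def)
      qed (auto simp: frac_lt_1)
      then have "u - t = of_int (\<lfloor>u\<rfloor> - \<lfloor>t\<rfloor>)" by (simp add: frac_def)
      moreover have "\<bar>u - t\<bar> < 1" using that by (auto simp: I_def abs_if)
      ultimately have "\<bar>\<lfloor>u\<rfloor> - \<lfloor>t\<rfloor>\<bar> < 1" by linarith
      then show ?thesis using \<open>u - t = of_int (\<lfloor>u\<rfloor> - \<lfloor>t\<rfloor>)\<close> by simp
    qed
    have small: "\<forall>\<^sub>F s in at 0. \<bar>s\<bar> < \<epsilon>"
      using \<epsilon> by (auto simp: eventually_at intro!: exI[of _ \<epsilon>])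
    have clim: "(c \<longlongrightarrow> \<gamma> t) (at 0)"
      using has_vector_derivative_continuous[OF cder] c0 by (simp add: continuous_within)
    have \<tau>lim: "(\<tau> \<longlongrightarrow> t) (at 0)"
    proof (rule tendstoI)
      fix \<delta> :: real assume \<delta>: "\<delta> > 0"
      define K where "K = I \<inter> {u. \<delta> \<le> dist u t}"
      have "closed {u. \<delta> \<le> dist u t}" by (intro closed_Collect_le continuous_intros)
      then have "compact K" unfolding K_def I_def by (intro compact_Int_closed) auto
      then have "closed (\<gamma> ` K)" by (intro compact_imp_closed compact_continuous_image cont)
      then have "open (- \<gamma> ` K)" by auto
      moreover have "\<gamma> t \<in> - \<gamma> ` K"
      proof
        assume "\<gamma> t \<in> \<gamma> ` K"
        then obtain u where "u \<in> K" "\<gamma> u = \<gamma> t" by force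
        then show False using uniq[of u] \<delta> by (auto simp: K_def)
      qed
      ultimately have "\<forall>\<^sub>F s in at 0. c s \<in> - \<gamma> ` K" by (rule topological_tendstoD[OF clim])
      with small show "\<forall>\<^sub>F s in at 0. dist (\<tau> s) t < \<delta>"
      proof eventually_elim
        case (elim s)
        then have "\<tau> s \<notin> K" using \<tau>[of s] by (metis ComplD imageI)
        then show ?case using \<tau>[of s] elim by (auto simp: K_def)
      qed
    qed
    define u where "u = \<gamma>' t"
    define Q where "Q = (\<lambda>r. if r = t then u else (1 / (r - t)) *\<^sub>R (\<gamma> r - \<gamma> t))"
    have Q: "\<gamma> r - \<gamma> t = (r - t) *\<^sub>R Q r" for r by (simp add: Q_def)
    have "((\<lambda>r. (1 / (r - t)) *\<^sub>R (\<gamma> r - \<gamma> t)) \<longlongrightarrow> u) (at t)"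
      unfolding u_def by (rule difference_quotient_tendsto[OF der])
    then have "(Q \<longlongrightarrow> u) (at t)"
      by (rule Lim_transform_eventually) (auto simp: Q_def eventually_at_filter)
    then have Qlim: "((\<lambda>s. Q (\<tau> s)) \<longlongrightarrow> u) (at 0)"
      using isCont_tendsto_compose[OF _ \<tau>lim, of Q] by (simp add: isCont_def Q_def)
    define d where "d = (\<lambda>s. (1 / s) *\<^sub>R (c s - c 0))"
    have dlim: "(d \<longlongrightarrow> v) (at 0)"
      using difference_quotient_tendsto[OF cder] by (simp add: d_def)
    have unz: "u \<bullet> u \<noteq> 0" using nz by (simp add: u_def)
    have qlim: "((\<lambda>s. Q (\<tau> s) \<bullet> u) \<longlongrightarrow> u \<bullet> u) (at 0)" by (intro tendsto_intros Qlim)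
    then have "\<forall>\<^sub>F s in at 0. Q (\<tau> s) \<bullet> u \<noteq> 0" using unz by (rule tendsto_imp_eventually_ne)
    with small have eq: "\<forall>\<^sub>F s in at 0. (d s \<bullet> u / (Q (\<tau> s) \<bullet> u)) *\<^sub>R Q (\<tau> s) = d s"
    proof eventually_elim
      case (elim s)
      have "c s - c 0 = (\<tau> s - t) *\<^sub>R Q (\<tau> s)" using Q[of "\<tau> s"] \<tau>[of s] elim c0 by simp
      then show ?case using elim by (simp add: d_def)
    qed
    have "((\<lambda>s. (d s \<bullet> u / (Q (\<tau> s) \<bullet> u)) *\<^sub>R Q (\<tau> s)) \<longlongrightarrow> (v \<bullet> u / (u \<bullet> u)) *\<^sub>R u) (at 0)"
      by (intro tendsto_intros Qlim dlim unz)
    then have "(d \<longlongrightarrow> (v \<bullet> u / (u \<bullet> u)) *\<^sub>R u) (at 0)"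
      using eq by (rule Lim_transform_eventually)
    then have "v = (v \<bullet> u / (u \<bullet> u)) *\<^sub>R u"
      using dlim tendsto_unique[of "at (0::real)"] by auto
    then show "v \<in> span {\<gamma>' t}" unfolding u_def by (metis span_base span_scale singletonI)
  qed
qed


section \<open>The tangent-point energy\<close>

text \<open>
  In \<^typ>\<open>ennreal\<close> one has \<open>a / 0 = \<infinity>\<close> for \<open>a > 0\<close>, and \<open>1 / \<infinity> = 0\<close>. So for \<open>x \<noteq> y\<close> the radius lies in
  \<open>(0, \<infinity>]\<close>, and it is infinite if \<open>x - y\<close> is tangential. For \<open>x = y\<close> the value is meaningless.
\<close>

definition tangent_point_radius :: "'a::real_normed_vector set \<Rightarrow> 'a \<Rightarrow> 'a \<Rightarrow> ennreal" where
  "tangent_point_radius \<Gamma> x y =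
     ennreal ((norm (x - y))\<^sup>2) / ennreal (2 * infdist (x - y) (tangent_line \<Gamma> x))"

text \<open>
  The radius is only defined for \<open>x \<noteq> y\<close>, whence the inner integral omits the point \<open>y\<close>; points are
  null sets of the Hausdorff measure.
\<close>

definition tangent_point_energy :: "'a::real_normed_vector set \<Rightarrow> ennreal" where
  "tangent_point_energy \<Gamma> =
     (\<integral>\<^sup>+y\<in>\<Gamma>. (\<integral>\<^sup>+x\<in>\<Gamma> - {y}. 1 / tangent_point_radius \<Gamma> x y \<partial>hausdorff1) \<partial>hausdorff1)"


section \<open>Planar convex curves\<close>

text \<open>
  The boundary of a two-dimensional convex body relative to the plane it spans; \<open>rel_frontier\<close> is
  the boundary relative to the affine hull, which is that plane.
\<close>

definition planar_convex_curve :: "'a::euclidean_space set \<Rightarrow> bool" where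
  "planar_convex_curve \<Gamma> \<longleftrightarrow>
     (\<exists>K. convex K \<and> compact K \<and> aff_dim K = 2 \<and> \<Gamma> = rel_frontier K)"

end

theory Submission
  imports Defs
begin

text \<open>
  Fix a point \<open>y = \<gamma> s\<close> of the curve and let \<open>dir s t\<close> be the direction from \<open>y\<close> to \<open>\<gamma> t\<close>, a curve on
  the unit sphere. An elementary computation shows that \<open>1 / R\<^sub>t\<^sub>p(\<gamma> t, y)\<close> is twice the speed of this
  spherical curve with respect to the arc length of \<open>\<gamma>\<close>
  (\<open>inverse_tangent_point_radius_ge\<close>). The inner integral of the energy is therefore twice the length of
  the spherical curve. When \<open>t\<close> runs through a period, the direction starts at the unit tangent at \<open>y\<close> and
  ends at its negative, so this length is at least \<open>\<pi>\<close>. Integration over \<open>y\<close> yields the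
  inequality.
  
  The lower bound for the inner integral is obtained arc by arc: \<open>angle_le_energy_arc\<close> bounds the
  integral over an arc from below by twice the angle
  between the directions to its endpoints. It follows from an estimate on small arcs, where the
  Hausdorff measure of an arc is at least the length of its chord. For two intermediate points one
  obtains the bound \<open>2 * turning s t u\<close>, where \<open>turning s t u\<close> is the length of the spherical polygon from
  the unit tangent over \<open>dir s t\<close> and \<open>dir s u\<close> to the antipode (\<open>turning_le_energy\<close>); it is at least \<open>\<pi>\<close>
  by the triangle inequality on the sphere.
  
  If \<open>turning s t u > \<pi>\<close> for some \<open>s\<close>, the same holds with a uniform gap for all nearby points by
  continuity, and the inequality is strict (\<open>energy_gt\<close>). In the case of equality all these polygons have
  length \<open>\<pi>\<close>, so that from each point \<open>y\<close> of the curve the directions move monotonically along a half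
  great circle. The curve then lies in a half-plane bounded by the tangent line at \<open>y\<close>. In
  particular it is planar, and \<open>y\<close> is a relative boundary point of its convex hull \<open>K\<close>
  (\<open>curve_subset_rel_frontier\<close>). Conversely, a relative boundary point of \<open>K\<close> lies on a segment joining two
  points of the curve within a supporting line, which is the tangent line at these points. By monotonicity
  of the directions the curve must run along this segment (\<open>tangential_chord_subset\<close>), so the point belongs
  to the curve. Hence the curve is the relative boundary of \<open>K\<close>.
\<close>

section \<open>Angles between unit vectors\<close>

text \<open>
  The spherical distance. It is only used for unit vectors, where \<open>a \<bullet> b\<close> lies in the domain
  \<open>[-1, 1]\<close> of \<open>arccos\<close>.
\<close>

definition angle :: "'a::real_inner \<Rightarrow> 'a \<Rightarrow> real" where
  "angle a b = arccos (a \<bullet> b)"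

lemma abs_inner_unit_le:
  fixes a b :: "'a::real_inner"
  assumes "norm a = 1" "norm b = 1"
  shows "\<bar>a \<bullet> b\<bar> \<le> 1"
  using Cauchy_Schwarz_ineq2[of a b] assms by simp

lemma angle_bounds:
  assumes "norm a = 1" "norm b = 1"
  shows "0 \<le> angle a b" "angle a b \<le> pi" "cos (angle a b) = a \<bullet> b"
  using abs_inner_unit_le[OF assms] unfolding angle_def
  by (auto intro: arccos_lbound arccos_ubound simp: cos_arccos_abs abs_le_iff)

lemma norm_perp:
  assumes "norm a = 1" "norm p = 1"
  shows "norm (p - (p \<bullet> a) *\<^sub>R a) = sin (angle a p)"
proof -
  have 1: "a \<bullet> a = 1" "p \<bullet> p = 1"
    using assms by (simp_all add: dot_square_norm)
  have "(norm (p - (p \<bullet> a) *\<^sub>R a))\<^sup>2 = 1 - (a \<bullet> p)\<^sup>2"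
    unfolding power2_norm_eq_inner using 1
    by (simp add: inner_diff_left inner_diff_right inner_commute power2_eq_square algebra_simps)
  also have "\<dots> = (sin (angle a p))\<^sup>2"
    using angle_bounds[OF assms] by (simp add: sin_squared_eq)
  finally show ?thesis
    using angle_bounds[OF assms] by (auto intro: power2_eq_imp_eq sin_ge_zero)
qed

lemma angle_commute: "angle a b = angle b a"
  by (simp add: angle_def inner_commute)

lemma angle_minus_right:
  assumes "norm a = 1" "norm b = 1"
  shows "angle a (- b) = pi - angle a b"
  using abs_inner_unit_le[OF assms] by (simp add: angle_def arccos_minus abs_le_iff)

text \<open>
  Split \<open>a\<close> and \<open>c\<close> into their components along and orthogonal to \<open>b\<close>. By Cauchy--Schwarz for the
  orthogonal components, \<open>a \<bullet> c\<close> is at least the cosine of the sum of the two angles; beyond \<open>\<pi>\<close>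
  there is nothing to show.
\<close>

lemma angle_triangle:
  assumes "norm a = 1" "norm b = 1" "norm c = 1"
  shows "angle a c \<le> angle a b + angle b c"
proof (cases "angle a b + angle b c \<le> pi")
  case True
  let ?p = "a - (a \<bullet> b) *\<^sub>R b" and ?q = "c - (c \<bullet> b) *\<^sub>R b"
  have "b \<bullet> b = 1" using assms by (simp add: dot_square_norm)
  then have "a \<bullet> c = (a \<bullet> b) * (b \<bullet> c) + ?p \<bullet> ?q"
    by (simp add: inner_diff_left inner_diff_right inner_commute algebra_simps)
  moreover have "?p \<bullet> ?q \<ge> - (norm ?p * norm ?q)"
    using Cauchy_Schwarz_ineq2[of ?p ?q] by linarith
  ultimately have "cos (angle a b + angle b c) \<le> a \<bullet> c"
    using norm_perp[of b a] norm_perp[of b c] angle_bounds(3)[of a b] angle_bounds(3)[of b c] assms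
    by (simp add: cos_add angle_commute)
  then have "arccos (a \<bullet> c) \<le> arccos (cos (angle a b + angle b c))"
    using abs_inner_unit_le[of a c] assms by (intro arccos_le_arccos) auto
  then show ?thesis
    using True angle_bounds[of a b] angle_bounds[of b c] assms by (simp add: angle_def arccos_cos)
next
  case False
  then show ?thesis using angle_bounds(2)[of a c] assms by linarith
qed

text \<open>
  Equality in the triangle inequality puts \<open>b\<close> on a geodesic from \<open>a\<close> to \<open>c\<close>. The conclusion says that
  seen from \<open>a\<close> the points \<open>b\<close> and \<open>c\<close> lie in the same direction on the sphere: the components
  orthogonal to \<open>a\<close> satisfy equality in Cauchy--Schwarz. In this form the degenerate cases in which one
  of them vanishes are included.
\<close>

lemma angle_additive_perp:
  assumes unit: "norm a = 1" "norm b = 1" "norm c = 1"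
    and eq: "angle a c = angle a b + angle b c"
  defines "p \<equiv> b - (b \<bullet> a) *\<^sub>R a" and "q \<equiv> c - (c \<bullet> a) *\<^sub>R a"
  shows "p \<bullet> q = norm p * norm q"
proof -
  have "a \<bullet> a = 1" using unit by (simp add: dot_square_norm)
  then have "p \<bullet> q = b \<bullet> c - (a \<bullet> b) * (a \<bullet> c)"
    by (simp add: p_def q_def inner_diff_left inner_diff_right inner_commute algebra_simps)
  also have "\<dots> = cos (angle a c - angle a b) - cos (angle a b) * cos (angle a c)"
    using eq angle_bounds(3)[OF unit(1,2)] angle_bounds(3)[OF unit(1,3)] angle_bounds(3)[OF unit(2,3)]
    by simp
  also have "\<dots> = norm p * norm q"
    using unit by (simp add: p_def q_def norm_perp cos_diff)
  finally show ?thesis .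
qed

text \<open>
  Arc and chord on the unit sphere agree to first order: the chord of an arc \<open>\<theta>\<close> is
  \<open>2 sin (\<theta>/2)\<close>, and \<open>arcsin\<close> has derivative \<open>1\<close> at \<open>0\<close>.
\<close>

lemma angle_le_norm_diff:
  fixes \<epsilon> :: real
  assumes "\<epsilon> > 0"
  obtains \<delta> where "\<delta> > 0"
    and "\<And>a b :: 'a::real_inner. norm a = 1 \<Longrightarrow> norm b = 1 \<Longrightarrow> norm (a - b) < \<delta> \<Longrightarrow>
           angle a b \<le> (1 + \<epsilon>) * norm (a - b)"
proof -
  have "(arcsin has_derivative (\<lambda>h. h)) (at 0)"
    using DERIV_arcsin[of 0] by (simp add: has_field_derivative_def mult_1[abs_def])
  then obtain d where d: "d > 0" "\<And>y. norm y < d \<Longrightarrow> norm (arcsin y - y) \<le> \<epsilon> * norm y"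
    using assms unfolding has_derivative_at_alt by force
  show ?thesis
  proof
    show "d > 0" by fact
    fix a b :: 'a assume u: "norm a = 1" "norm b = 1" and s: "norm (a - b) < d"
    define \<theta> where "\<theta> = angle a b"
    have \<theta>: "0 \<le> \<theta>" "\<theta> \<le> pi" "cos \<theta> = a \<bullet> b" using angle_bounds[OF u] by (auto simp: \<theta>_def)
    have "a \<bullet> a = 1" "b \<bullet> b = 1" using u by (simp_all add: dot_square_norm)
    then have "(norm (a - b))\<^sup>2 = 2 - 2 * cos (2 * (\<theta> / 2))"
      using \<theta> unfolding power2_norm_eq_inner
      by (simp add: inner_diff_left inner_diff_right inner_commute)
    also have "\<dots> = (2 * sin (\<theta> / 2))\<^sup>2"
      by (simp only: cos_double_sin power_mult_distrib) simp
    finally have sq: "(norm (a - b))\<^sup>2 = (2 * sin (\<theta> / 2))\<^sup>2" .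
    have "0 \<le> 2 * sin (\<theta> / 2)" using \<theta> by (simp add: sin_ge_zero)
    then have n: "norm (a - b) = 2 * sin (\<theta> / 2)"
      by (rule power2_eq_imp_eq[OF sq norm_ge_zero])
    have "\<theta> / 2 = arcsin (norm (a - b) / 2)"
      using \<theta> n by (simp add: arcsin_sin)
    moreover have "norm (a - b) / 2 < d" using s d(1) by linarith
    then have "\<bar>arcsin (norm (a - b) / 2) - norm (a - b) / 2\<bar> \<le> \<epsilon> * (norm (a - b) / 2)"
      using d(2)[of "norm (a - b) / 2"] by simp
    ultimately have "\<theta> / 2 \<le> norm (a - b) / 2 + \<epsilon> * (norm (a - b) / 2)"
      by linarith
    then show "angle a b \<le> (1 + \<epsilon>) * norm (a - b)"
      by (simp add: \<theta>_def algebra_simps)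
  qed
qed

lemma tendsto_angle:
  assumes "(f \<longlongrightarrow> a) F" "(g \<longlongrightarrow> b) F" "norm a = 1" "norm b = 1"
    and "\<forall>\<^sub>F x in F. norm (f x) = 1" "\<forall>\<^sub>F x in F. norm (g x) = 1"
  shows "((\<lambda>x. angle (f x) (g x)) \<longlongrightarrow> angle a b) F"
  unfolding angle_def
proof (rule continuous_on_tendsto_compose[OF continuous_on_arccos'])
  show "((\<lambda>x. f x \<bullet> g x) \<longlongrightarrow> a \<bullet> b) F" by (intro tendsto_intros assms)
  show "a \<bullet> b \<in> {- 1..1}" using abs_inner_unit_le[of a b] assms by (auto simp: abs_le_iff)
  show "\<forall>\<^sub>F x in F. f x \<bullet> g x \<in> {- 1..1}"
    using assms(5,6)
  proof eventually_elim
    case (elim x)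
    then show ?case using abs_inner_unit_le[of "f x" "g x"] by (auto simp: abs_le_iff)
  qed
qed

section \<open>Superadditivity of the integral\<close>

text \<open>
  The integral of an arbitrary function is the supremum of the integrals of the simple functions below
  it. A sum of simple functions below \<open>f\<close> and \<open>g\<close> is a simple function below \<open>f + g\<close>, whence one half
  of additivity holds for all functions. It allows integrals of the tangent-point radius over
  consecutive arcs to be added up.
\<close>

lemma nn_integral_superadditive:
  "(\<integral>\<^sup>+x. f x \<partial>M) + (\<integral>\<^sup>+x. g x \<partial>M) \<le> (\<integral>\<^sup>+x. f x + g x \<partial>M)"
proof -
  let ?S = "\<lambda>f. {u. simple_function M u \<and> u \<le> f}"
  have ne: "?S f \<noteq> {}" for f :: "'a \<Rightarrow> ennreal"
    by (auto intro!: exI[of _ "\<lambda>_. 0"] simp: le_fun_def)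
  have le: "integral\<^sup>S M u + integral\<^sup>S M v \<le> (\<integral>\<^sup>+x. f x + g x \<partial>M)"
    if "u \<in> ?S f" "v \<in> ?S g" for u v
  proof -
    have "integral\<^sup>S M u + integral\<^sup>S M v = integral\<^sup>S M (\<lambda>x. u x + v x)"
      using that by (intro simple_integral_add[symmetric]) auto
    also have "\<dots> = (\<integral>\<^sup>+x. u x + v x \<partial>M)"
      using that by (intro nn_integral_eq_simple_integral[symmetric] simple_function_add) auto
    also have "\<dots> \<le> (\<integral>\<^sup>+x. f x + g x \<partial>M)"
      using that by (intro nn_integral_mono add_mono) (auto simp: le_fun_def)
    finally show ?thesis .
  qed
  have "(\<integral>\<^sup>+x. f x \<partial>M) + (\<integral>\<^sup>+x. g x \<partial>M) =
      (SUP u\<in>?S f. integral\<^sup>S M u) + (SUP v\<in>?S g. integral\<^sup>S M v)"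
    by (simp only: nn_integral_def)
  also have "\<dots> = (SUP u\<in>?S f. integral\<^sup>S M u + (SUP v\<in>?S g. integral\<^sup>S M v))"
    by (rule ennreal_SUP_add_left[OF ne, symmetric])
  also have "\<dots> = (SUP u\<in>?S f. SUP v\<in>?S g. integral\<^sup>S M u + integral\<^sup>S M v)"
    by (simp only: ennreal_SUP_add_right[OF ne])
  also have "\<dots> \<le> (\<integral>\<^sup>+x. f x + g x \<partial>M)"
    by (intro SUP_least le)
  finally show ?thesis .
qed

lemma set_nn_integral_superadditive:
  assumes "A \<inter> B = {}" "A \<union> B \<subseteq> C"
  shows "(\<integral>\<^sup>+x\<in>A. f x \<partial>M) + (\<integral>\<^sup>+x\<in>B. f x \<partial>M) \<le> (\<integral>\<^sup>+x\<in>C. f x \<partial>M)"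
proof -
  have "(\<integral>\<^sup>+x\<in>A. f x \<partial>M) + (\<integral>\<^sup>+x\<in>B. f x \<partial>M) \<le>
      (\<integral>\<^sup>+x. f x * indicator A x + f x * indicator B x \<partial>M)"
    by (rule nn_integral_superadditive)
  also have "\<dots> \<le> (\<integral>\<^sup>+x\<in>C. f x \<partial>M)"
    using assms by (intro nn_integral_mono) (auto split: split_indicator)
  finally show ?thesis .
qed

section \<open>Hausdorff measure of arcs\<close>

text \<open>
  A \<open>1\<close>-Lipschitz function maps a set of diameter \<open>d\<close> into an interval of length \<open>d\<close>, so that it turns
  every cover of \<open>A\<close> into a cover of \<open>[0, D)\<close> by intervals of the same total length. The interval is
  half-open because it is applied to half-open arcs.
\<close>

lemma length_le_hausdorff_outer:
  fixes f :: "'a::metric_space \<Rightarrow> real"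
  assumes lip: "\<And>x y. dist (f x) (f y) \<le> dist x y" and cov: "{0..<D} \<subseteq> f ` A"
  shows "ennreal D \<le> hausdorff_outer A"
proof -
  have "ennreal D \<le> hausdorff_pre 1 A"
    unfolding hausdorff_pre_def
  proof (intro INF_greatest, clarify)
    fix U :: "nat \<Rightarrow> 'a set"
    assume U: "A \<subseteq> (\<Union>i. U i)" "\<forall>i. bounded (U i) \<and> diameter (U i) \<le> 1"
    define V where "V = (\<lambda>i. if U i = {} then {} else {Inf (f ` U i)..Inf (f ` U i) + diameter (U i)})"
    have dl: "\<bar>f x - f y\<bar> \<le> diameter (U i)" if "x \<in> U i" "y \<in> U i" for x y i
      using lip[of x y] diameter_bounded_bound[of "U i" x y] U that by (auto simp: dist_real_def)
    have sub: "f ` U i \<subseteq> V i" for i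
    proof
      fix v assume "v \<in> f ` U i"
      then obtain x where x: "x \<in> U i" "v = f x" by auto
      have low: "f x - diameter (U i) \<le> f y" if "y \<in> U i" for y
        using dl[OF x(1) that] by (simp add: abs_le_iff)
      then have "bdd_below (f ` U i)" by (auto intro!: bdd_belowI2[of _ "f x - diameter (U i)"])
      then have "Inf (f ` U i) \<le> f x" using x by (intro cINF_lower)
      moreover have "f x - diameter (U i) \<le> Inf (f ` U i)"
        using x low by (intro cINF_greatest) auto
      ultimately show "v \<in> V i" using x by (auto simp: V_def)
    qed
    have "ennreal D = emeasure lborel {0..<D}"
      by (cases "D \<ge> 0") (auto simp: ennreal_neg)
    also have "\<dots> \<le> emeasure lborel (\<Union>i. V i)"
    proof (rule emeasure_mono)
      have "{0..<D} \<subseteq> f ` (\<Union>i. U i)" by (rule order_trans[OF cov image_mono[OF U(1)]])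
      then have "{0..<D} \<subseteq> (\<Union>i. f ` U i)" by (simp add: image_UN)
      also have "\<dots> \<subseteq> (\<Union>i. V i)" by (intro UN_mono sub subset_refl)
      finally show "{0..<D} \<subseteq> (\<Union>i. V i)" .
      show "(\<Union>i. V i) \<in> sets lborel" by (intro sets.countable_UN) (auto simp: V_def)
    qed
    also have "\<dots> \<le> (\<Sum>i. emeasure lborel (V i))"
      by (intro emeasure_subadditive_countably) (auto simp: V_def)
    also have "\<dots> \<le> (\<Sum>i. ennreal (diameter (U i)))"
      using U by (intro suminf_le summableI) (auto simp: V_def diameter_ge_0)
    finally show "ennreal D \<le> (\<Sum>i. ennreal (diameter (U i)))" .
  qed
  also have "\<dots> \<le> hausdorff_outer A" by (rule hausdorff_pre_le_outer) simp
  finally show ?thesis .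
qed

text \<open>
  The distance to the initial point of an arc is \<open>1\<close>-Lipschitz, and along the arc it takes all values
  from \<open>0\<close> up to the length of the chord.
\<close>

lemma chord_le_hausdorff_outer:
  fixes \<gamma> :: "real \<Rightarrow> 'a::metric_space"
  assumes "continuous_on {c..d} \<gamma>" "c \<le> d"
  shows "ennreal (dist (\<gamma> c) (\<gamma> d)) \<le> hausdorff_outer (\<gamma> ` {c..<d})"
proof (rule length_le_hausdorff_outer[where f = "dist (\<gamma> c)"])
  show "dist (dist (\<gamma> c) x) (dist (\<gamma> c) y) \<le> dist x y" for x y
    by (simp add: dist_real_def abs_le_iff) (smt (verit) dist_commute dist_triangle)
  show "{0..<dist (\<gamma> c) (\<gamma> d)} \<subseteq> dist (\<gamma> c) ` \<gamma> ` {c..<d}"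
  proof
    fix v assume v: "v \<in> {0..<dist (\<gamma> c) (\<gamma> d)}"
    have "\<exists>x\<ge>c. x \<le> d \<and> dist (\<gamma> c) (\<gamma> x) = v"
      using v assms by (intro IVT') (auto intro!: continuous_intros)
    then obtain x where x: "c \<le> x" "x \<le> d" "dist (\<gamma> c) (\<gamma> x) = v" by auto
    then have "x \<noteq> d" using v by auto
    with x show "v \<in> dist (\<gamma> c) ` \<gamma> ` {c..<d}" by (auto intro!: image_eqI)
  qed
qed

lemma hausdorff_outer_lipschitz_image:
  fixes \<gamma> :: "real \<Rightarrow> 'a::real_normed_vector"
  assumes lip: "\<And>s t. s \<in> {0..1} \<Longrightarrow> t \<in> {0..1} \<Longrightarrow> norm (\<gamma> s - \<gamma> t) \<le> L * \<bar>s - t\<bar>" and L: "L \<ge> 0"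
  shows "hausdorff_outer (\<gamma> ` {0..1}) \<le> ennreal L"
  unfolding hausdorff_outer_def
proof (intro SUP_least)
  fix \<delta> :: real assume "\<delta> \<in> {0<..}"
  then have \<delta>: "\<delta> > 0" by simp
  obtain n :: nat where n: "n > 0" "L / n \<le> \<delta>"
  proof -
    obtain n :: nat where "L / \<delta> < n" using reals_Archimedean2 by blast
    then show ?thesis using that[of "Suc n"] \<delta> L by (simp add: field_simps)
  qed
  define U where "U = (\<lambda>i. if i < n then \<gamma> ` {i / n..Suc i / n} else {})"
  have i1: "Suc i / n \<le> 1" if "i < n" for i using that n by (simp add: field_simps)
  have d: "norm (x - y) \<le> L / n" if xy: "x \<in> U i" "y \<in> U i" for x y i
  proof -
    have i: "i < n" using xy by (auto simp: U_def split: if_splits)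
    then obtain s t where st: "x = \<gamma> s" "y = \<gamma> t" "s \<in> {i / n..Suc i / n}" "t \<in> {i / n..Suc i / n}"
      using xy by (auto simp: U_def)
    have "0 \<le> s" "0 \<le> t" using st by (auto intro: order_trans[of 0 "real i / real n"])
    moreover have "s \<le> 1" "t \<le> 1" using st i1[OF i] by auto
    ultimately have "norm (x - y) \<le> L * \<bar>s - t\<bar>" unfolding st by (intro lip) auto
    also have "\<dots> \<le> L * (1 / n)"
    proof (intro mult_left_mono L)
      have "real (Suc i) / n = i / n + 1 / n" using n by (simp add: field_simps)
      then show "\<bar>s - t\<bar> \<le> 1 / n" using st by (auto simp: abs_le_iff)
    qed
    finally show ?thesis by simp
  qed
  have dia: "diameter (U i) \<le> L / n" for i
    using d L by (intro diameter_le) auto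
  have "hausdorff_pre \<delta> (\<gamma> ` {0..1}) \<le> (\<Sum>i. ennreal (diameter (U i)))"
    unfolding hausdorff_pre_def
  proof (intro INF_lower CollectI conjI allI)
    show "\<gamma> ` {0..1} \<subseteq> (\<Union>i. U i)"
    proof
      fix x assume "x \<in> \<gamma> ` {0..1}"
      then obtain t where t: "0 \<le> t" "t \<le> 1" "x = \<gamma> t" by auto
      define i where "i = (if t = 1 then n - 1 else nat \<lfloor>t * n\<rfloor>)"
      have "i < n \<and> real i \<le> t * n \<and> t * n \<le> Suc i"
      proof (cases "t = 1")
        case False
        then have "t * n < n" using t n by auto
        moreover have "0 \<le> t * n" using t by auto
        moreover have "i = nat \<lfloor>t * n\<rfloor>" using False by (simp add: i_def)
        ultimately show ?thesis by (auto; linarith)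
      qed (use n in \<open>auto simp: i_def of_nat_diff\<close>)
      then have "x \<in> U i" using t n by (auto simp: U_def field_simps)
      then show "x \<in> (\<Union>i. U i)" by auto
    qed
    show "bounded (U i)" for i
    proof (cases "U i = {}")
      case False
      then obtain a where "a \<in> U i" by auto
      then show ?thesis using d unfolding bounded_any_center[of _ a] by (auto simp: dist_norm intro!: exI[of _ "L / n"] bounded_subset)
    qed simp
    show "diameter (U i) \<le> \<delta>" for i using dia[of i] n by linarith
  qed
  also have "\<dots> = (\<Sum>i<n. ennreal (diameter (U i)))"
    by (rule suminf_finite) (auto simp: U_def)
  also have "\<dots> \<le> (\<Sum>i<n. ennreal (L / n))"
    by (intro sum_mono ennreal_leI dia)
  also have "\<dots> = ennreal L"
    using n L by (simp flip: ennreal_of_nat_eq_real_of_nat ennreal_mult) (simp add: ennreal_of_nat_eq_real_of_nat flip: ennreal_mult)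
  finally show "hausdorff_pre \<delta> (\<gamma> ` {0..1}) \<le> ennreal L" .
qed

lemma borel_continuous_image_interval:
  fixes \<gamma> :: "real \<Rightarrow> 'a::metric_space"
  assumes "continuous_on {c..d} \<gamma>" "inj_on \<gamma> {c..d}"
  shows "\<gamma> ` {c..<d} \<in> sets borel"
proof -
  have "\<gamma> ` {c..<d} = (if c \<le> d then \<gamma> ` {c..d} - {\<gamma> d} else {})"
  proof -
    have "{c..<d} = {c..d} - {d}" "c \<le> d \<Longrightarrow> d \<in> {c..d}" by auto
    then show ?thesis
      using inj_on_image_set_diff[OF assms(2), of "{c..d}" "{d}"] by auto
  qed
  moreover have "closed (\<gamma> ` {c..d})"
    by (intro compact_imp_closed compact_continuous_image assms) auto
  ultimately show ?thesis by auto
qed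

section \<open>Distance from a line, and increments\<close>

text \<open>
  Both \<open>norm v\<close> times the distance of \<open>w\<close> from the line of \<open>v\<close> and \<open>norm w\<close> times the distance of \<open>v\<close>
  from the line of \<open>w\<close> are the area of the parallelogram spanned by \<open>v\<close> and \<open>w\<close>. The vector \<open>z\<close> of the
  proof is the component of \<open>w\<close> orthogonal to \<open>v\<close>.
\<close>

lemma infdist_span_singleton_ge:
  fixes v w :: "'a::real_inner"
  assumes "v \<noteq> 0" "w \<noteq> 0"
  shows "norm (v - (v \<bullet> sgn w) *\<^sub>R sgn w) * norm w / norm v \<le> infdist w (span {v})"
proof -
  define k where "k = w \<bullet> v / (v \<bullet> v)"
  define z where "z = w - k *\<^sub>R v"
  have vv: "v \<bullet> v > 0" using assms by auto
  have zv: "z \<bullet> v = 0" "v \<bullet> z = 0"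
    using vv by (simp_all add: z_def k_def inner_diff_left inner_diff_right inner_commute)
  have wz: "w = z + k *\<^sub>R v" by (simp add: z_def)
  have "(norm (v - (v \<bullet> sgn w) *\<^sub>R sgn w) * norm w)\<^sup>2 = (v \<bullet> v) * (w \<bullet> w) - (v \<bullet> w)\<^sup>2"
  proof -
    have s: "sgn w \<bullet> sgn w = 1" using assms by (simp add: dot_square_norm norm_sgn)
    have w: "v \<bullet> w = norm w * (v \<bullet> sgn w)" using assms by (simp add: sgn_div_norm)
    have "(norm (v - (v \<bullet> sgn w) *\<^sub>R sgn w))\<^sup>2 = v \<bullet> v - (v \<bullet> sgn w)\<^sup>2"
      unfolding power2_norm_eq_inner using s
      by (simp add: inner_diff_left inner_diff_right inner_commute power2_eq_square algebra_simps)
    then show ?thesis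
      unfolding w power_mult_distrib by (simp add: power2_norm_eq_inner[of w] right_diff_distrib mult.commute)
  qed
  also have "\<dots> = (norm z * norm v)\<^sup>2"
    unfolding wz power_mult_distrib power2_norm_eq_inner using zv
    by (simp add: inner_add_left inner_add_right power2_eq_square algebra_simps)
  finally have eq: "norm (v - (v \<bullet> sgn w) *\<^sub>R sgn w) * norm w = norm z * norm v"
    by (rule power2_eq_imp_eq) auto
  have "norm z \<le> dist w x" if x: "x \<in> span {v}" for x
  proof (cases "z = 0")
    case False
    obtain c where c: "x = c *\<^sub>R v" using x by (auto simp: span_singleton)
    have "norm z * norm z = z \<bullet> z"
      by (simp add: norm_eq_sqrt_inner)
    also have "\<dots> = z \<bullet> (w - x)"
      using zv by (simp add: wz c inner_diff_right inner_add_right)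
    also have "\<dots> \<le> norm z * norm (w - x)" by (rule norm_cauchy_schwarz)
    finally show ?thesis using False by (simp add: dist_norm)
  qed simp
  then have "norm z \<le> infdist w (span {v})"
    unfolding infdist_def using span_zero[of "{v}"] by (auto intro!: cINF_greatest)
  then show ?thesis using eq assms by simp
qed

text \<open>
  The derivative controls increments over small intervals that contain the point \<open>x\<close> anywhere, not only
  as an endpoint.
\<close>

lemma straddle_vector:
  assumes "(f has_vector_derivative D) (at x)" and "\<eta> > 0"
  obtains \<delta> where "\<delta> > 0"
    and "\<And>c d. c \<le> x \<Longrightarrow> x \<le> d \<Longrightarrow> d - c < \<delta> \<Longrightarrow> norm (f d - f c - (d - c) *\<^sub>R D) \<le> \<eta> * (d - c)"
proof -
  obtain \<delta> where \<delta>: "\<delta> > 0"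
      "\<And>y. norm (y - x) < \<delta> \<Longrightarrow> norm (f y - f x - (y - x) *\<^sub>R D) \<le> \<eta> * norm (y - x)"
    using assms unfolding has_vector_derivative_def has_derivative_at_alt by blast
  show ?thesis
  proof
    fix c d assume cd: "c \<le> x" "x \<le> d" "d - c < \<delta>"
    have "f d - f c - (d - c) *\<^sub>R D = (f d - f x - (d - x) *\<^sub>R D) - (f c - f x - (c - x) *\<^sub>R D)"
      by (simp add: algebra_simps)
    then have "norm (f d - f c - (d - c) *\<^sub>R D) \<le>
        norm (f d - f x - (d - x) *\<^sub>R D) + norm (f c - f x - (c - x) *\<^sub>R D)"
      by (simp only: norm_triangle_ineq4)
    also have "\<dots> \<le> \<eta> * norm (d - x) + \<eta> * norm (c - x)"
      using cd by (intro add_mono \<delta>) auto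
    also have "\<dots> = \<eta> * (d - c)" using cd by (simp add: algebra_simps)
    finally show "norm (f d - f c - (d - c) *\<^sub>R D) \<le> \<eta> * (d - c)" .
  qed fact
qed

section \<open>Closed curves of class $C^{1,\alpha}$\<close>

locale holder_closed_curve =
  fixes \<alpha> :: real and \<gamma> \<gamma>' :: "real \<Rightarrow> 'a::euclidean_space"
  assumes exponent_pos: "\<alpha> > 0" and param: "C1_holder_closed_param \<alpha> \<gamma> \<gamma>'"
begin

lemma periodic: "\<gamma> (t + 1) = \<gamma> t"
  and injective: "inj_on \<gamma> {0..<1}"
  and deriv: "(\<gamma> has_vector_derivative \<gamma>' t) (at t)"
  and regular: "\<gamma>' t \<noteq> 0"
  using param by (auto simp: C1_holder_closed_param_def)

lemma continuous_deriv: "isCont \<gamma>' t"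
proof -
  obtain C where C: "\<And>s t. norm (\<gamma>' s - \<gamma>' t) \<le> C * \<bar>s - t\<bar> powr \<alpha>"
    using param by (auto simp: C1_holder_closed_param_def)
  have "((\<lambda>s. C * \<bar>s - t\<bar> powr \<alpha>) \<longlongrightarrow> C * 0) (at t)"
    using exponent_pos
    by (intro tendsto_mult tendsto_const tendsto_zero_powrI[where b = \<alpha>])
       (auto intro!: tendsto_eq_intros)
  then have "((\<lambda>s. norm (\<gamma>' s - \<gamma>' t)) \<longlongrightarrow> 0) (at t)"
    by (intro tendsto_sandwich[of "\<lambda>_. 0" "\<lambda>s. norm (\<gamma>' s - \<gamma>' t)" "at t" "\<lambda>s. C * \<bar>s - t\<bar> powr \<alpha>"])
       (use C in auto)
  then show ?thesis by (simp add: isCont_def tendsto_norm_zero_iff LIM_zero_iff)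
qed

lemma isCont_curve: "isCont \<gamma> t"
  using deriv by (rule has_vector_derivative_continuous)

lemma continuous_on_curve: "continuous_on A \<gamma>"
  by (intro continuous_at_imp_continuous_on ballI isCont_curve)

lemma periodic_int: "\<gamma> (t + of_int k) = \<gamma> t"
proof (induction k rule: int_induct[where k = 0])
  case (step1 i)
  then show ?case using periodic[of "t + of_int i"] by (simp add: add_ac)
next
  case (step2 i)
  then show ?case using periodic[of "t + of_int (i - 1)"] by (simp add: add_ac)
qed simp

lemma curve_eqD:
  assumes "\<gamma> a = \<gamma> b" "\<bar>a - b\<bar> < 1"
  shows "a = b"
proof -
  have "frac a = frac b"
  proof (rule inj_onD[OF injective])
    show "\<gamma> (frac a) = \<gamma> (frac b)"
      using assms periodic_int[of a "- \<lfloor>a\<rfloor>"] periodic_int[of b "- \<lfloor>b\<rfloor>"] by (simp add: frac_def)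
  qed (auto simp: frac_lt_1)
  then have eq: "a - b = of_int (\<lfloor>a\<rfloor> - \<lfloor>b\<rfloor>)" by (simp add: frac_def)
  with assms(2) have "\<bar>\<lfloor>a\<rfloor> - \<lfloor>b\<rfloor>\<bar> < 1" by linarith
  then show ?thesis using eq by simp
qed

lemma curve_neq: "s < t \<Longrightarrow> t < s + 1 \<Longrightarrow> \<gamma> t \<noteq> \<gamma> s"
  using curve_eqD[of t s] by auto

lemma range_curve: "range \<gamma> = \<gamma> ` {s..<s + 1}"
proof -
  have "\<gamma> t \<in> \<gamma> ` {s..<s + 1}" for t
  proof (rule image_eqI)
    show "\<gamma> t = \<gamma> (t + of_int (- \<lfloor>t - s\<rfloor>))" by (rule periodic_int[symmetric])
    show "t + of_int (- \<lfloor>t - s\<rfloor>) \<in> {s..<s + 1}" by (auto; linarith)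
  qed
  then show ?thesis by auto
qed

lemma compact_curve: "compact (range \<gamma>)"
proof -
  have "range \<gamma> = \<gamma> ` {0..1}"
    using range_curve[of 0] by (fastforce simp: image_iff)
  then show ?thesis
    by (simp add: compact_continuous_image continuous_on_curve)
qed

lemma borel_arc: "d < c + 1 \<Longrightarrow> \<gamma> ` {c..<d} \<in> sets borel"
  by (intro borel_continuous_image_interval continuous_on_curve inj_onI curve_eqD) auto

lemma chord_le_measure_arc:
  assumes "c \<le> d" "d < c + 1"
  shows "ennreal (norm (\<gamma> d - \<gamma> c)) \<le> emeasure hausdorff1 (\<gamma> ` {c..<d})"
  using chord_le_hausdorff_outer[OF continuous_on_curve assms(1)] borel_arc[OF assms(2)]
  by (simp add: emeasure_hausdorff1 dist_norm norm_minus_commute)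

text \<open>
  The curve is Lipschitz because its derivative is bounded on a period.
\<close>

lemma finite_length: "emeasure hausdorff1 (range \<gamma>) < top"
proof -
  have "compact (\<gamma>' ` {0..1})"
    by (intro compact_continuous_image continuous_at_imp_continuous_on ballI continuous_deriv) auto
  then obtain L where L: "\<And>t. t \<in> {0..1} \<Longrightarrow> norm (\<gamma>' t) \<le> L"
    by (meson bounded_iff compact_imp_bounded image_eqI)
  have "norm (\<gamma> s - \<gamma> t) \<le> L * \<bar>s - t\<bar>" if "s \<in> {0..1}" "t \<in> {0..1}" for s t
    using differentiable_bound[of "{0..1}" \<gamma> "\<lambda>t h. h *\<^sub>R \<gamma>' t" L s t] that L deriv
    by (simp add: has_vector_derivative_def has_derivative_at_withinI onorm_scaleR_left onorm_id)
  moreover have "L \<ge> 0" using L[of 0] norm_ge_zero[of "\<gamma>' 0"] by (simp del: norm_ge_zero)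
  ultimately have "hausdorff_outer (\<gamma> ` {0..1}) \<le> ennreal L"
    by (intro hausdorff_outer_lipschitz_image)
  moreover have "range \<gamma> \<subseteq> \<gamma> ` {0..1}"
    using range_curve[of 0] by fastforce
  ultimately have "hausdorff_outer (range \<gamma>) \<le> ennreal L"
    using hausdorff_outer_mono order_trans by blast
  moreover have "range \<gamma> \<in> sets borel"
    by (intro borel_closed compact_imp_closed compact_curve)
  ultimately show ?thesis
    by (simp add: emeasure_hausdorff1 order_le_less_trans[OF _ ennreal_less_top])
qed


section \<open>The direction from a point of the curve and the tangent-point radius\<close>

definition dir :: "real \<Rightarrow> real \<Rightarrow> 'a" where
  "dir s t = sgn (\<gamma> t - \<gamma> s)"

text \<open>
  The derivative of \<open>dir s\<close>, see \<open>dir_has_vector_derivative\<close>: the component of the velocity orthogonal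
  to the line of sight from \<open>\<gamma> s\<close>, divided by the distance.
\<close>

definition dir_deriv :: "real \<Rightarrow> real \<Rightarrow> 'a" where
  "dir_deriv s t = (\<gamma>' t - (\<gamma>' t \<bullet> dir s t) *\<^sub>R dir s t) /\<^sub>R norm (\<gamma> t - \<gamma> s)"

definition tangent :: "real \<Rightarrow> 'a" where
  "tangent s = sgn (\<gamma>' s)"

lemma norm_dir: "s < t \<Longrightarrow> t < s + 1 \<Longrightarrow> norm (dir s t) = 1"
  using curve_neq by (simp add: dir_def norm_sgn)

lemma norm_tangent: "norm (tangent s) = 1"
  using regular by (simp add: tangent_def norm_sgn)

lemma dir_has_vector_derivative:
  assumes "s < t" "t < s + 1"
  shows "(dir s has_vector_derivative dir_deriv s t) (at t)"
proof -
  define w where "w = \<gamma> t - \<gamma> s"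
  have w: "w \<noteq> 0" using curve_neq[OF assms] by (simp add: w_def)
  have 1: "((\<lambda>t. \<gamma> t - \<gamma> s) has_derivative (\<lambda>h. h *\<^sub>R \<gamma>' t)) (at t)"
    using deriv[of t] unfolding has_vector_derivative_def by (auto intro!: derivative_eq_intros)
  have 2: "((\<lambda>t. norm (\<gamma> t - \<gamma> s)) has_derivative (\<lambda>h. (h *\<^sub>R \<gamma>' t) \<bullet> sgn w)) (at t)"
    using has_derivative_compose[OF 1 has_derivative_norm] w by (simp add: w_def)
  have "((\<lambda>t. inverse (norm (\<gamma> t - \<gamma> s)) *\<^sub>R (\<gamma> t - \<gamma> s)) has_derivative
      (\<lambda>h. inverse (norm w) *\<^sub>R (h *\<^sub>R \<gamma>' t) +
        (- (inverse (norm w) * ((h *\<^sub>R \<gamma>' t) \<bullet> sgn w) * inverse (norm w))) *\<^sub>R w)) (at t)"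
    using has_derivative_scaleR[OF Deriv.has_derivative_inverse[OF _ 2] 1] w by (simp add: w_def)
  also have "(\<lambda>h. inverse (norm w) *\<^sub>R (h *\<^sub>R \<gamma>' t) +
        (- (inverse (norm w) * ((h *\<^sub>R \<gamma>' t) \<bullet> sgn w) * inverse (norm w))) *\<^sub>R w) =
      (\<lambda>h. h *\<^sub>R dir_deriv s t)"
  proof
    fix h
    have "(- (inverse (norm w) * ((h *\<^sub>R \<gamma>' t) \<bullet> sgn w) * inverse (norm w))) *\<^sub>R w =
        - (inverse (norm w) * h * (\<gamma>' t \<bullet> sgn w)) *\<^sub>R sgn w"
      by (subst (2) sgn_div_norm) simp
    then show "inverse (norm w) *\<^sub>R (h *\<^sub>R \<gamma>' t) +
        (- (inverse (norm w) * ((h *\<^sub>R \<gamma>' t) \<bullet> sgn w) * inverse (norm w))) *\<^sub>R w = h *\<^sub>R dir_deriv s t"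
      by (simp add: dir_deriv_def dir_def w_def[symmetric] scaleR_diff_right mult.commute mult.left_commute)
  qed
  finally have "((\<lambda>t. inverse (norm (\<gamma> t - \<gamma> s)) *\<^sub>R (\<gamma> t - \<gamma> s)) has_derivative
      (\<lambda>h. h *\<^sub>R dir_deriv s t)) (at t)" .
  then show ?thesis
    unfolding has_vector_derivative_def dir_def sgn_div_norm by simp
qed

text \<open>
  This is where the tangent-point radius enters. Up to the factor \<open>2\<close>, its inverse is the speed at which
  the direction seen from \<open>\<gamma> s\<close> turns, per unit of arc length: both are the area of the parallelogram
  spanned by \<open>\<gamma> t - \<gamma> s\<close> and the unit tangent at \<open>\<gamma> t\<close>, divided by the squared distance.
\<close>

lemma inverse_tangent_point_radius_ge:
  assumes "s < t" "t < s + 1"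
  shows "ennreal (2 * norm (dir_deriv s t) / norm (\<gamma>' t))
    \<le> 1 / tangent_point_radius (range \<gamma>) (\<gamma> t) (\<gamma> s)"
proof -
  define w where "w = \<gamma> t - \<gamma> s"
  have w: "norm w > 0" using curve_neq[OF assms] by (simp add: w_def)
  have v: "norm (\<gamma>' t) > 0" using regular by simp
  define b where "b = 2 * infdist w (span {\<gamma>' t})"
  have "norm (\<gamma>' t - (\<gamma>' t \<bullet> sgn w) *\<^sub>R sgn w) * norm w / norm (\<gamma>' t) \<le> b / 2"
    using infdist_span_singleton_ge[of "\<gamma>' t" w] w regular by (simp add: b_def)
  moreover have "norm (dir_deriv s t) = norm (\<gamma>' t - (\<gamma>' t \<bullet> sgn w) *\<^sub>R sgn w) / norm w"
    unfolding dir_deriv_def dir_def w_def[symmetric] by (simp only: norm_scaleR) (simp add: divide_inverse)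
  ultimately have "2 * norm (dir_deriv s t) / norm (\<gamma>' t) \<le> b / (norm w)\<^sup>2"
    using w v by (simp add: field_simps power2_eq_square)
  then have "ennreal (2 * norm (dir_deriv s t) / norm (\<gamma>' t)) \<le> ennreal (b / (norm w)\<^sup>2)"
    by (rule ennreal_leI)
  also have "\<dots> = 1 / (ennreal ((norm w)\<^sup>2) / ennreal b)"
  proof (cases "b = 0")
    case False
    then have "b > 0" by (simp add: b_def infdist_nonneg less_le)
    then show ?thesis
      using w by (simp add: divide_ennreal ennreal_1[symmetric] del: ennreal_1)
  qed (use w in \<open>simp add: ennreal_divide_zero\<close>)
  also have "\<dots> = 1 / tangent_point_radius (range \<gamma>) (\<gamma> t) (\<gamma> s)"
    by (simp add: tangent_point_radius_def tangent_line_param[OF param] b_def w_def)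
  finally show ?thesis .
qed

end

section \<open>The energy bounds the turning of the direction\<close>

lemma ennreal_add_le: "ennreal (x + y) \<le> ennreal x + ennreal y"
proof (cases "x \<ge> 0 \<and> y \<ge> 0")
  case False
  then have "x + y \<le> max x y" by auto
  then have "ennreal (x + y) \<le> ennreal (max x y)" by (rule ennreal_leI)
  also have "\<dots> \<le> ennreal x + ennreal y" by (simp add: max_def)
  finally show ?thesis .
qed simp

context holder_closed_curve
begin

abbreviation inverse_radius :: "real \<Rightarrow> 'a \<Rightarrow> ennreal" where
  "inverse_radius s x \<equiv> 1 / tangent_point_radius (range \<gamma>) x (\<gamma> s)"

lemma isCont_dir_deriv:
  assumes "s < t" "t < s + 1"
  shows "isCont (dir_deriv s) t"
proof -
  have "norm (\<gamma> t - \<gamma> s) \<noteq> 0" "\<gamma> t - \<gamma> s \<noteq> 0" using curve_neq[OF assms] by simp_all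
  then show ?thesis
    unfolding dir_deriv_def[abs_def] dir_def
    by (intro continuous_intros continuous_deriv isCont_curve) auto
qed

text \<open>
  On a short arc around \<open>\<gamma> \<tau>\<close> the inverse radius is almost constant, the measure is at least the length
  of the chord, and the direction turns by little more than its velocity times the length of the
  parameter interval. The error \<open>\<epsilon> * (d - c)\<close> is proportional to the length of the interval, so that it
  stays small when intervals are put together. The point \<open>\<tau>\<close> may lie anywhere in \<open>[c, d]\<close>, as the
  bisection principle \<open>Bolzano\<close> demands.
\<close>

lemma angle_le_energy_local:
  assumes \<tau>: "s < \<tau>" "\<tau> < s + 1" and \<epsilon>: "\<epsilon> > 0"
  shows "\<exists>\<delta>>0. \<forall>c d. c \<le> \<tau> \<and> \<tau> \<le> d \<and> d - c < \<delta> \<longrightarrow>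
    ennreal (2 * angle (dir s c) (dir s d) - \<epsilon> * (d - c)) \<le>
      (\<integral>\<^sup>+x\<in>\<gamma> ` {c..<d}. inverse_radius s x \<partial>hausdorff1)"
proof -
  define k where "k = (\<lambda>t. 2 * norm (dir_deriv s t) / norm (\<gamma>' t))"
  define U where "U = norm (dir_deriv s \<tau>)"
  define V where "V = norm (\<gamma>' \<tau>)"
  define K where "K = k \<tau>"
  have V: "V > 0" using regular by (simp add: V_def)
  have U: "U \<ge> 0" and K: "K \<ge> 0" and KV: "K * V = 2 * U"
    using V by (simp_all add: U_def K_def k_def V_def[symmetric])
  \<comment> \<open>the tolerance for inverse radius and speed; it makes the final error at most \<open>\<epsilon>\<close>\<close>
  define \<eta> where "\<eta> = min V (\<epsilon> / (K + V + 2))"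
  have \<eta>: "\<eta> > 0" "\<eta> \<le> V" using V K \<epsilon> by (auto simp: \<eta>_def)
  have "\<eta> \<le> \<epsilon> / (K + V + 2)" by (simp add: \<eta>_def)
  then have \<eta>\<epsilon>: "\<eta> * (K + V + 2) \<le> \<epsilon>" using K V by (simp add: pos_le_divide_eq)
  \<comment> \<open>the tolerance for the direction and for the ratio of arc and chord\<close>
  define \<zeta> where "\<zeta> = min 1 (\<eta> / (U + 2))"
  have \<zeta>: "\<zeta> > 0" "\<zeta> \<le> 1" using U \<eta> by (auto simp: \<zeta>_def)
  have "\<zeta> \<le> \<eta> / (U + 2)" by (simp add: \<zeta>_def)
  then have "\<zeta> * (U + 2) \<le> \<eta>" using U by (simp add: pos_le_divide_eq)
  moreover have "\<zeta> * \<zeta> \<le> \<zeta> * 1" using \<zeta> by (intro mult_left_mono) auto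
  ultimately have \<zeta>\<eta>: "(1 + \<zeta>) * (U + \<zeta>) \<le> U + \<eta>" by (simp add: algebra_simps)
  have "isCont k \<tau>"
    unfolding k_def using regular
    by (intro continuous_intros isCont_dir_deriv[OF \<tau>] continuous_deriv) auto
  then obtain \<delta>1 where \<delta>1: "\<delta>1 > 0" "\<And>t. \<bar>t - \<tau>\<bar> < \<delta>1 \<Longrightarrow> \<bar>k t - k \<tau>\<bar> < \<eta>"
    using \<eta>(1) unfolding continuous_at_eps_delta dist_real_def by metis
  obtain \<delta>2 where \<delta>2: "\<delta>2 > 0"
    "\<And>c d. c \<le> \<tau> \<Longrightarrow> \<tau> \<le> d \<Longrightarrow> d - c < \<delta>2 \<Longrightarrow> norm (\<gamma> d - \<gamma> c - (d - c) *\<^sub>R \<gamma>' \<tau>) \<le> \<eta> * (d - c)"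
    using straddle_vector[OF deriv \<eta>(1)] by blast
  obtain \<delta>3 where \<delta>3: "\<delta>3 > 0"
    "\<And>c d. c \<le> \<tau> \<Longrightarrow> \<tau> \<le> d \<Longrightarrow> d - c < \<delta>3 \<Longrightarrow>
      norm (dir s d - dir s c - (d - c) *\<^sub>R dir_deriv s \<tau>) \<le> \<zeta> * (d - c)"
    using straddle_vector[OF dir_has_vector_derivative[OF \<tau>] \<zeta>(1)] by blast
  obtain \<delta>4 where \<delta>4: "\<delta>4 > 0"
    "\<And>a b :: 'a. norm a = 1 \<Longrightarrow> norm b = 1 \<Longrightarrow> norm (a - b) < \<delta>4 \<Longrightarrow> angle a b \<le> (1 + \<zeta>) * norm (a - b)"
    using angle_le_norm_diff[OF \<zeta>(1)] by blast
  define \<delta> where "\<delta> = Min {\<delta>1, \<delta>2, \<delta>3, \<delta>4 / (U + 1), \<tau> - s, s + 1 - \<tau>}"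
  have \<delta>_pos: "\<delta> > 0"
    unfolding \<delta>_def using \<delta>1(1) \<delta>2(1) \<delta>3(1) \<delta>4(1) U \<tau> by (subst Min_gr_iff) auto
  have \<delta>: "\<delta> \<le> \<delta>1" "\<delta> \<le> \<delta>2" "\<delta> \<le> \<delta>3" "\<delta> \<le> \<delta>4 / (U + 1)" "\<delta> \<le> \<tau> - s" "\<delta> \<le> s + 1 - \<tau>"
    unfolding \<delta>_def by (rule Min_le, simp, simp)+
  have "ennreal (2 * angle (dir s c) (dir s d) - \<epsilon> * (d - c)) \<le>
      (\<integral>\<^sup>+x\<in>\<gamma> ` {c..<d}. inverse_radius s x \<partial>hausdorff1)"
    if cd: "c \<le> \<tau>" "\<tau> \<le> d" "d - c < \<delta>" for c d
  proof -
    have in_period: "s < t" "t < s + 1" if "t \<in> {c..d}" for t using that cd \<delta> by auto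
    have cd0: "d - c \<ge> 0" using cd by simp
    define m where "m = max 0 (K - \<eta>)"
    have "m \<le> k t" if "t \<in> {c..d}" for t
      using \<delta>1(2)[of t] that cd \<delta> unfolding m_def K_def by (simp add: k_def, linarith)
    then have low: "ennreal m \<le> inverse_radius s (\<gamma> t)" if "t \<in> {c..d}" for t
      using inverse_tangent_point_radius_ge[of s t] in_period[OF that] that
      unfolding k_def by (meson ennreal_leI order_trans)
    \<comment> \<open>the chord is almost as long as the velocity predicts\<close>
    have "norm ((d - c) *\<^sub>R \<gamma>' \<tau>) \<le> norm (\<gamma> d - \<gamma> c) + norm (\<gamma> d - \<gamma> c - (d - c) *\<^sub>R \<gamma>' \<tau>)"
      by (metis norm_triangle_sub norm_minus_commute add.commute)
    moreover have "norm ((d - c) *\<^sub>R \<gamma>' \<tau>) = V * (d - c)" using cd0 by (simp add: V_def)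
    ultimately have chord: "(V - \<eta>) * (d - c) \<le> norm (\<gamma> d - \<gamma> c)"
      using \<delta>2(2)[of c d] cd \<delta> unfolding left_diff_distrib by linarith
    \<comment> \<open>the direction turns hardly faster than its velocity predicts\<close>
    have "norm (dir s d - dir s c) \<le>
        norm ((d - c) *\<^sub>R dir_deriv s \<tau>) + norm (dir s d - dir s c - (d - c) *\<^sub>R dir_deriv s \<tau>)"
      by (rule norm_triangle_sub)
    moreover have "norm ((d - c) *\<^sub>R dir_deriv s \<tau>) = U * (d - c)" using cd0 by (simp add: U_def)
    ultimately have turn: "norm (dir s d - dir s c) \<le> (U + \<zeta>) * (d - c)"
      using \<delta>3(2)[of c d] cd \<delta> unfolding distrib_right by linarith
    also have "\<dots> \<le> (U + 1) * (d - c)" using \<zeta> cd0 by (intro mult_right_mono) auto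
    also have "\<dots> < \<delta>4"
    proof -
      have "d - c < \<delta>4 / (U + 1)" using cd \<delta>(4) by linarith
      moreover have "U + 1 > 0" using U by simp
      ultimately show ?thesis by (metis pos_less_divide_eq mult.commute)
    qed
    finally have "norm (dir s c - dir s d) < \<delta>4" by (simp add: norm_minus_commute)
    then have "angle (dir s c) (dir s d) \<le> (1 + \<zeta>) * norm (dir s c - dir s d)"
      using in_period cd cd0 by (intro \<delta>4(2) norm_dir) auto
    also have "\<dots> \<le> (1 + \<zeta>) * ((U + \<zeta>) * (d - c))"
      using turn \<zeta> by (intro mult_left_mono) (auto simp: norm_minus_commute)
    also have "\<dots> \<le> (U + \<eta>) * (d - c)"
      using mult_right_mono[OF \<zeta>\<eta> cd0] by (simp add: mult.assoc)
    finally have "2 * angle (dir s c) (dir s d) - \<epsilon> * (d - c) \<le> (K * V + 2 * \<eta> - \<epsilon>) * (d - c)"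
      unfolding KV by (simp add: algebra_simps)
    also have "\<dots> \<le> ((K - \<eta>) * (V - \<eta>)) * (d - c)"
    proof (rule mult_right_mono[OF _ cd0])
      have "(K - \<eta>) * (V - \<eta>) = K * V - \<eta> * (K + V) + \<eta> * \<eta>" by (simp add: algebra_simps)
      moreover have "\<eta> * \<eta> \<ge> 0" by simp
      moreover have "\<eta> * (K + V + 2) = \<eta> * (K + V) + 2 * \<eta>" by (simp add: algebra_simps)
      ultimately show "K * V + 2 * \<eta> - \<epsilon> \<le> (K - \<eta>) * (V - \<eta>)"
        using \<eta>\<epsilon> by linarith
    qed
    also have "\<dots> \<le> (m * (V - \<eta>)) * (d - c)"
      using \<eta> cd0 by (intro mult_right_mono) (auto simp: m_def)
    also have "\<dots> \<le> m * norm (\<gamma> d - \<gamma> c)"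
      using chord by (simp add: mult.assoc mult_left_mono m_def)
    finally have "ennreal (2 * angle (dir s c) (dir s d) - \<epsilon> * (d - c)) \<le> ennreal (m * norm (\<gamma> d - \<gamma> c))"
      by (rule ennreal_leI)
    also have "\<dots> = ennreal m * ennreal (norm (\<gamma> d - \<gamma> c))"
      by (intro ennreal_mult) (auto simp: m_def)
    also have "\<dots> \<le> ennreal m * emeasure hausdorff1 (\<gamma> ` {c..<d})"
      using cd cd0 \<delta> by (intro mult_left_mono chord_le_measure_arc) auto
    also have "\<dots> = (\<integral>\<^sup>+x\<in>\<gamma> ` {c..<d}. ennreal m \<partial>hausdorff1)"
      using borel_arc[of d c] cd \<delta> by (simp add: nn_integral_cmult_indicator)
    also have "\<dots> \<le> (\<integral>\<^sup>+x\<in>\<gamma> ` {c..<d}. inverse_radius s x \<partial>hausdorff1)"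
      using low by (intro nn_integral_mono) (auto split: split_indicator)
    finally show ?thesis .
  qed
  with \<delta>_pos show ?thesis by blast
qed

text \<open>
  The local estimate is additive in the interval, by the triangle inequality for angles on the one side
  and superadditivity of the integral on the other. By bisection it holds on the whole interval, and the
  error is arbitrarily small.
\<close>

lemma angle_le_energy_arc:
  assumes ab: "s < a" "a \<le> b" "b < s + 1"
  shows "ennreal (2 * angle (dir s a) (dir s b)) \<le>
    (\<integral>\<^sup>+x\<in>\<gamma> ` {a..<b}. inverse_radius s x \<partial>hausdorff1)"
proof (rule ennreal_le_epsilon)
  fix e :: real assume e: "e > 0"
  define E where "E = (\<lambda>c d. \<integral>\<^sup>+x\<in>\<gamma> ` {c..<d}. inverse_radius s x \<partial>hausdorff1)"
  define P where "P = (\<lambda>c d. s < c \<longrightarrow> d < s + 1 \<longrightarrow>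
    ennreal (2 * angle (dir s c) (dir s d) - e * (d - c)) \<le> E c d)"
  have "P a b"
    using ab(2)
  proof (induction rule: Bolzano)
    case (trans c d f)
    show ?case unfolding P_def
    proof (intro impI)
      assume cf: "s < c" "f < s + 1"
      have "2 * angle (dir s c) (dir s f) - e * (f - c) \<le>
          (2 * angle (dir s c) (dir s d) - e * (d - c)) + (2 * angle (dir s d) (dir s f) - e * (f - d))"
        using angle_triangle[of "dir s c" "dir s d" "dir s f"] norm_dir trans cf
        by (simp add: algebra_simps)
      then have "ennreal (2 * angle (dir s c) (dir s f) - e * (f - c)) \<le>
          ennreal (2 * angle (dir s c) (dir s d) - e * (d - c)) + ennreal (2 * angle (dir s d) (dir s f) - e * (f - d))"
        by (rule order_trans[OF ennreal_leI ennreal_add_le])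
      also have "\<dots> \<le> E c d + E d f"
        using trans cf by (intro add_mono) (auto simp: P_def)
      also have "\<dots> \<le> E c f"
        unfolding E_def
      proof (rule set_nn_integral_superadditive)
        show "\<gamma> ` {c..<d} \<inter> \<gamma> ` {d..<f} = {}"
          using cf trans(3,4) by (auto dest!: curve_eqD)
        show "\<gamma> ` {c..<d} \<union> \<gamma> ` {d..<f} \<subseteq> \<gamma> ` {c..<f}"
          using trans(3,4) by (intro Un_least image_mono) auto
      qed
      finally show "ennreal (2 * angle (dir s c) (dir s f) - e * (f - c)) \<le> E c f" .
    qed
  next
    case (local x)
    then have "s < x" "x < s + 1" using ab by auto
    from angle_le_energy_local[OF this e] show ?case unfolding P_def E_def by blast
  qed
  then have "ennreal (2 * angle (dir s a) (dir s b) - e * (b - a)) \<le> E a b"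
    using ab by (simp add: P_def)
  moreover have "e * (b - a) \<le> e * 1" using ab e by (intro mult_left_mono) auto
  then have "ennreal (2 * angle (dir s a) (dir s b)) \<le>
      ennreal ((2 * angle (dir s a) (dir s b) - e * (b - a)) + e)"
    by (intro ennreal_leI) simp
  moreover have "\<dots> \<le> ennreal (2 * angle (dir s a) (dir s b) - e * (b - a)) + ennreal e"
    by (rule ennreal_add_le)
  ultimately show "ennreal (2 * angle (dir s a) (dir s b)) \<le>
      (\<integral>\<^sup>+x\<in>\<gamma> ` {a..<b}. inverse_radius s x \<partial>hausdorff1) + ennreal e"
    unfolding E_def by (meson add_right_mono order_trans)
qed

text \<open>
  The length of the spherical polygon with vertices \<open>tangent s\<close>, \<open>dir s t\<close>, \<open>dir s u\<close> and
  \<open>- tangent s\<close>, which is inscribed in the curve of directions seen from \<open>\<gamma> s\<close>.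
\<close>

definition turning :: "real \<Rightarrow> real \<Rightarrow> real \<Rightarrow> real" where
  "turning s t u = angle (tangent s) (dir s t) + angle (dir s t) (dir s u) + angle (dir s u) (- tangent s)"

lemma pi_le_turning:
  assumes "s < t" "t < s + 1" "s < u" "u < s + 1"
  shows "pi \<le> turning s t u"
proof -
  have "tangent s \<bullet> tangent s = 1" by (simp add: dot_square_norm norm_tangent)
  then have "pi = angle (tangent s) (- tangent s)" by (simp add: angle_def)
  also have "\<dots> \<le> angle (tangent s) (dir s u) + angle (dir s u) (- tangent s)"
    using norm_tangent norm_dir assms by (intro angle_triangle) auto
  also have "\<dots> \<le> angle (tangent s) (dir s t) + angle (dir s t) (dir s u) + angle (dir s u) (- tangent s)"
    using norm_tangent norm_dir assms by (intro add_right_mono angle_triangle) auto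
  finally show ?thesis by (simp add: turning_def)
qed

lemma dir_tendsto_tangent: "((\<lambda>h. dir s (s + h)) \<longlongrightarrow> tangent s) (at_right 0)"
proof -
  have "((\<lambda>h. (1 / h) *\<^sub>R (\<gamma> (s + h) - \<gamma> s)) \<longlongrightarrow> \<gamma>' s) (at_right 0)"
    using LIM_offset_zero[OF difference_quotient_tendsto[OF deriv[of s]]]
    by (simp add: filterlim_at_split)
  then have "((\<lambda>h. sgn ((1 / h) *\<^sub>R (\<gamma> (s + h) - \<gamma> s))) \<longlongrightarrow> tangent s) (at_right 0)"
    unfolding tangent_def using regular by (rule tendsto_sgn)
  then show ?thesis
    by (rule Lim_transform_eventually)
       (auto simp: dir_def sgn_scaleR eventually_at_filter)
qed

text \<open>
  At the end of a period the curve returns to \<open>\<gamma> s\<close> from behind.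
\<close>

lemma dir_tendsto_minus_tangent: "((\<lambda>h. dir s (s + 1 - h)) \<longlongrightarrow> - tangent s) (at_right 0)"
proof -
  have "((\<lambda>h. (1 / h) *\<^sub>R (\<gamma> (s + h) - \<gamma> s)) \<longlongrightarrow> \<gamma>' s) (at_left 0)"
    using LIM_offset_zero[OF difference_quotient_tendsto[OF deriv[of s]]]
    by (simp add: filterlim_at_split)
  then have "((\<lambda>h. (1 / - h) *\<^sub>R (\<gamma> (s - h) - \<gamma> s)) \<longlongrightarrow> \<gamma>' s) (at_right 0)"
    by (simp add: filterlim_at_left_to_right)
  then have "((\<lambda>h. - sgn ((1 / - h) *\<^sub>R (\<gamma> (s - h) - \<gamma> s))) \<longlongrightarrow> - tangent s) (at_right 0)"
    unfolding tangent_def using regular by (intro tendsto_minus tendsto_sgn)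
  moreover have "\<gamma> (s + 1 - h) = \<gamma> (s - h)" for h
    using periodic[of "s - h"] by (simp add: algebra_simps)
  ultimately show ?thesis
    by (elim Lim_transform_eventually)
       (auto simp: dir_def sgn_scaleR sgn_minus eventually_at_filter)
qed

text \<open>
  The arcs from \<open>s + h\<close> to \<open>t\<close>, from \<open>t\<close> to \<open>u\<close> and from \<open>u\<close> to \<open>s + 1 - h\<close> are disjoint; let \<open>h\<close>
  tend to \<open>0\<close>.
\<close>

lemma turning_le_energy:
  assumes "s < t" "t \<le> u" "u < s + 1"
  shows "ennreal (2 * turning s t u) \<le>
    (\<integral>\<^sup>+x\<in>range \<gamma> - {\<gamma> s}. inverse_radius s x \<partial>hausdorff1)" (is "_ \<le> ?E")
proof -
  define A where "A = (\<lambda>h. angle (dir s (s + h)) (dir s t) + angle (dir s t) (dir s u) +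
    angle (dir s u) (dir s (s + 1 - h)))"
  define m where "m = min (t - s) (s + 1 - u)"
  have m: "m > 0" using assms by (auto simp: m_def)
  have near: "\<forall>\<^sub>F h in at_right 0. h \<in> {0<..<m}"
    using m by (rule eventually_at_right_real)
  have "\<forall>\<^sub>F h in at_right 0. ennreal (2 * A h) \<le> ?E"
    using near
  proof eventually_elim
    case (elim h)
    then have h: "0 < h" "s + h < t" "u < s + 1 - h" by (auto simp: m_def)
    let ?I = "\<lambda>B. \<integral>\<^sup>+x\<in>B. inverse_radius s x \<partial>hausdorff1"
    have "2 * A h = 2 * angle (dir s (s + h)) (dir s t) + 2 * angle (dir s t) (dir s u) +
        2 * angle (dir s u) (dir s (s + 1 - h))"
      by (simp add: A_def)
    then have "ennreal (2 * A h) \<le> ennreal (2 * angle (dir s (s + h)) (dir s t)) +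
        ennreal (2 * angle (dir s t) (dir s u)) + ennreal (2 * angle (dir s u) (dir s (s + 1 - h)))"
      by (metis add_right_mono ennreal_add_le order_trans)
    also have "\<dots> \<le> ?I (\<gamma> ` {s + h..<t}) + ?I (\<gamma> ` {t..<u}) + ?I (\<gamma> ` {u..<s + 1 - h})"
      using h assms by (intro add_mono angle_le_energy_arc) auto
    also have "\<dots> \<le> ?I (\<gamma> ` {s + h..<u}) + ?I (\<gamma> ` {u..<s + 1 - h})"
      using h assms
      by (intro add_right_mono set_nn_integral_superadditive) (auto dest!: curve_eqD)
    also have "\<dots> \<le> ?E"
      using h assms
      by (intro set_nn_integral_superadditive) (auto dest!: curve_eqD)
    finally show ?case .
  qed
  moreover have "((\<lambda>h. ennreal (2 * A h)) \<longlongrightarrow> ennreal (2 * turning s t u)) (at_right 0)"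
  proof -
    have 1: "\<forall>\<^sub>F h in at_right 0. norm (dir s (s + h)) = 1"
      using near by eventually_elim (use assms in \<open>auto simp: m_def intro!: norm_dir\<close>)
    have 2: "\<forall>\<^sub>F h in at_right 0. norm (dir s (s + 1 - h)) = 1"
      using near by eventually_elim (use assms in \<open>auto simp: m_def intro!: norm_dir\<close>)
    show ?thesis
      unfolding A_def turning_def using assms 1 2
      by (intro tendsto_ennrealI tendsto_mult tendsto_add tendsto_const tendsto_angle
          dir_tendsto_tangent dir_tendsto_minus_tangent) (auto simp: norm_dir norm_tangent)
  qed
  ultimately show ?thesis
    by (intro tendsto_upperbound) auto
qed

end

section \<open>The inequality, and when it is strict\<close>

context holder_closed_curve
begin

lemma isCont_tangent: "isCont tangent s"
  unfolding tangent_def[abs_def] using regular by (intro continuous_intros continuous_deriv) auto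

lemma turning_tendsto:
  assumes "s < t" "t < s + 1" "s < u" "u < s + 1"
  shows "((\<lambda>r. turning r t u) \<longlongrightarrow> turning s t u) (at s)"
proof -
  have dir_lim: "((\<lambda>r. dir r v) \<longlongrightarrow> dir s v) (at s)"
    and dir_unit: "\<forall>\<^sub>F r in at s. norm (dir r v) = 1"
    if v: "s < v" "v < s + 1" for v
  proof -
    have "\<gamma> v - \<gamma> s \<noteq> 0" using curve_neq[OF v] by simp
    then show "((\<lambda>r. dir r v) \<longlongrightarrow> dir s v) (at s)"
      unfolding dir_def using isCont_curve[of s] by (intro tendsto_intros) (auto simp: isCont_def)
    have "\<forall>\<^sub>F r in at s. r \<in> {v - 1<..<v}"
      using v by (intro eventually_at_in_open') auto
    then show "\<forall>\<^sub>F r in at s. norm (dir r v) = 1"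
      by eventually_elim (auto intro: norm_dir)
  qed
  show ?thesis
    unfolding turning_def using assms isCont_tangent[of s]
    by (intro tendsto_add tendsto_angle tendsto_minus dir_lim)
       (auto simp: norm_dir norm_tangent dir_unit isCont_def)
qed

lemma borel_curve: "range \<gamma> \<in> sets borel"
  by (intro borel_closed compact_imp_closed compact_curve)

lemma energy_ge: "ennreal (2 * pi) * emeasure hausdorff1 (range \<gamma>) \<le> tangent_point_energy (range \<gamma>)"
proof -
  have "ennreal (2 * pi) * emeasure hausdorff1 (range \<gamma>) = (\<integral>\<^sup>+y\<in>range \<gamma>. ennreal (2 * pi) \<partial>hausdorff1)"
    using borel_curve by (simp add: nn_integral_cmult_indicator)
  also have "\<dots> \<le> tangent_point_energy (range \<gamma>)"
    unfolding tangent_point_energy_def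
  proof (rule nn_integral_mono)
    fix y :: 'a
    show "ennreal (2 * pi) * indicator (range \<gamma>) y \<le>
        (\<integral>\<^sup>+x\<in>range \<gamma> - {y}. 1 / tangent_point_radius (range \<gamma>) x y \<partial>hausdorff1) * indicator (range \<gamma>) y"
    proof (cases "y \<in> range \<gamma>")
      case True
      then obtain s where y: "y = \<gamma> s" by auto
      have "ennreal (2 * pi) \<le> ennreal (2 * turning s (s + 1/2) (s + 1/2))"
        using pi_le_turning[of s "s + 1/2" "s + 1/2"] by (intro ennreal_leI) simp
      also have "\<dots> \<le> (\<integral>\<^sup>+x\<in>range \<gamma> - {y}. inverse_radius s x \<partial>hausdorff1)"
        unfolding y by (rule turning_le_energy) auto
      finally show ?thesis using True by (simp add: y)
    qed simp
  qed
  finally show ?thesis .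
qed

text \<open>
  If one spherical polygon is longer than \<open>\<pi>\<close>, so are those seen from all points of a short arc \<open>A\<close>, by
  continuity. Since \<open>A\<close> has positive measure and the length of the whole curve is finite, the inequality
  is strict.
\<close>

lemma energy_gt:
  assumes stu: "s < t" "t \<le> u" "u < s + 1" and gt: "turning s t u > pi"
  shows "ennreal (2 * pi) * emeasure hausdorff1 (range \<gamma>) < tangent_point_energy (range \<gamma>)"
proof -
  define \<epsilon> where "\<epsilon> = (turning s t u - pi) / 2"
  have \<epsilon>: "\<epsilon> > 0" "pi + \<epsilon> < turning s t u" using gt by (simp_all add: \<epsilon>_def field_simps)
  have "\<forall>\<^sub>F r in at s. pi + \<epsilon> < turning r t u"
    using turning_tendsto[of s t u] stu \<epsilon>(2) by (intro order_tendstoD(1)) auto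
  then obtain d where d: "d > 0" "\<And>r. r \<noteq> s \<Longrightarrow> dist r s < d \<Longrightarrow> pi + \<epsilon> < turning r t u"
    unfolding eventually_at by auto
  define h where "h = min (d / 2) (min ((t - s) / 2) (1 / 2))"
  have h: "h > 0" "h < d" "s + h < t" "h < 1" using d stu by (auto simp: h_def min_def field_simps)
  define A where "A = \<gamma> ` {s..<s + h}"
  have A: "A \<in> sets borel" "A \<subseteq> range \<gamma>" using borel_arc[of "s + h" s] h by (auto simp: A_def)
  have "norm (\<gamma> (s + h) - \<gamma> s) > 0" using curve_neq[of s "s + h"] h by simp
  then have A_pos: "emeasure hausdorff1 A > 0"
    using chord_le_measure_arc[of s "s + h"] h unfolding A_def
    by (metis add_less_cancel_left ennreal_less_zero_iff less_add_same_cancel1 less_le_trans less_imp_le)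
  let ?G = "\<lambda>y. \<integral>\<^sup>+x\<in>range \<gamma> - {y}. 1 / tangent_point_radius (range \<gamma>) x y \<partial>hausdorff1"
  have base: "ennreal (2 * turning r v w) \<le> ?G (\<gamma> r)" if "r < v" "v \<le> w" "w < r + 1" for r v w
    using turning_le_energy[OF that] .
  have low: "ennreal (2 * pi) * indicator (range \<gamma>) y + ennreal (2 * \<epsilon>) * indicator A y \<le>
      ?G y * indicator (range \<gamma>) y" for y
  proof (cases "y \<in> A")
    case True
    then obtain r where r: "y = \<gamma> r" "s \<le> r" "r < s + h" by (auto simp: A_def)
    have "pi + \<epsilon> \<le> turning r t u"
      using d(2)[of r] \<epsilon>(2) r h by (cases "r = s") (auto simp: dist_real_def)
    then have "ennreal (2 * pi + 2 * \<epsilon>) \<le> ennreal (2 * turning r t u)"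
      by (intro ennreal_leI) simp
    moreover have "ennreal (2 * pi + 2 * \<epsilon>) = ennreal (2 * pi) + ennreal (2 * \<epsilon>)"
      by (rule ennreal_plus) (use \<epsilon>(1) in auto)
    ultimately have "ennreal (2 * pi) + ennreal (2 * \<epsilon>) \<le> ennreal (2 * turning r t u)"
      by simp
    also have "\<dots> \<le> ?G y" unfolding r(1) using r h stu by (intro base) auto
    finally show ?thesis using True A by (auto simp: subset_iff)
  next
    case False
    show ?thesis
    proof (cases "y \<in> range \<gamma>")
      case True
      then obtain r where y: "y = \<gamma> r" by auto
      have "ennreal (2 * pi) \<le> ennreal (2 * turning r (r + 1/2) (r + 1/2))"
        using pi_le_turning[of r "r + 1/2" "r + 1/2"] by (intro ennreal_leI) simp
      also have "\<dots> \<le> ?G y" unfolding y by (rule base) auto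
      finally show ?thesis using True False by simp
    qed (use False in simp)
  qed
  have fin: "ennreal (2 * pi) * emeasure hausdorff1 (range \<gamma>) < top"
    using finite_length by (simp add: ennreal_mult_less_top)
  have "ennreal (2 * pi) * emeasure hausdorff1 (range \<gamma>) <
      ennreal (2 * pi) * emeasure hausdorff1 (range \<gamma>) + ennreal (2 * \<epsilon>) * emeasure hausdorff1 A"
  proof -
    have "0 < ennreal (2 * \<epsilon>) * emeasure hausdorff1 A"
      using A_pos \<epsilon> by (simp add: ennreal_zero_less_mult_iff)
    then show ?thesis
      using fin ennreal_add_left_cancel_less[of "ennreal (2 * pi) * emeasure hausdorff1 (range \<gamma>)" 0] by simp
  qed
  also have "\<dots> = (\<integral>\<^sup>+y. ennreal (2 * pi) * indicator (range \<gamma>) y + ennreal (2 * \<epsilon>) * indicator A y \<partial>hausdorff1)"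
    using borel_curve A by (subst nn_integral_add) (auto simp: nn_integral_cmult_indicator)
  also have "\<dots> \<le> tangent_point_energy (range \<gamma>)"
    unfolding tangent_point_energy_def by (intro nn_integral_mono low)
  finally show ?thesis .
qed

lemma turning_eq_pi:
  assumes "ennreal (2 * pi) * emeasure hausdorff1 (range \<gamma>) = tangent_point_energy (range \<gamma>)"
    and "s < t" "t \<le> u" "u < s + 1"
  shows "turning s t u = pi"
proof (rule antisym)
  show "pi \<le> turning s t u" using assms by (intro pi_le_turning) auto
  show "turning s t u \<le> pi"
  proof (rule ccontr)
    assume "\<not> ?thesis"
    then show False using energy_gt[of s t u] assms by simp
  qed
qed

section \<open>The case of equality\<close>

text \<open>
  By Rolle's theorem, the coordinate along a line that contains the curve would have a critical point,
  and there the velocity would vanish.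
\<close>

lemma not_collinear: "\<not> collinear (range \<gamma>)"
proof
  assume "collinear (range \<gamma>)"
  then obtain v where v: "\<And>x y. x \<in> range \<gamma> \<Longrightarrow> y \<in> range \<gamma> \<Longrightarrow> \<exists>c. x - y = c *\<^sub>R v"
    unfolding collinear_def by blast
  define f where "f = (\<lambda>t. (\<gamma> t - \<gamma> 0) \<bullet> v)"
  have df: "(f has_real_derivative \<gamma>' t \<bullet> v) (at t)" for t
    unfolding f_def has_real_derivative_iff_has_vector_derivative
    by (auto intro!: derivative_eq_intros deriv bounded_linear.has_vector_derivative[OF bounded_linear_inner_left])
  have "\<gamma> t = \<gamma> 0 + (f t / (v \<bullet> v)) *\<^sub>R v" for t
  proof -
    obtain c where "\<gamma> t - \<gamma> 0 = c *\<^sub>R v" using v by blast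
    then show ?thesis by (cases "v = 0") (auto simp: f_def algebra_simps)
  qed
  then have \<gamma>_eq: "\<gamma> = (\<lambda>t. \<gamma> 0 + (f t / (v \<bullet> v)) *\<^sub>R v)" by blast
  have "\<exists>z>0. z < 1 \<and> (*) (\<gamma>' z \<bullet> v) = (\<lambda>_. 0)"
  proof (rule Rolle_deriv)
    show "f 0 = f 1" using periodic[of 0] by (simp add: f_def)
    show "continuous_on {0..1} f"
      unfolding f_def by (intro continuous_intros continuous_on_curve)
    show "(f has_derivative (*) (\<gamma>' x \<bullet> v)) (at x)" for x
      using df by (simp add: has_field_derivative_def)
  qed simp
  then obtain z where "\<gamma>' z \<bullet> v = 0" by (metis mult.right_neutral)
  then have "(f has_vector_derivative 0) (at z)"
    using df[of z] by (simp add: has_real_derivative_iff_has_vector_derivative)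
  then have "((\<lambda>t. \<gamma> 0 + (f t / (v \<bullet> v)) *\<^sub>R v) has_vector_derivative 0) (at z)"
    by (auto intro!: derivative_eq_intros simp: divide_inverse has_real_derivative_iff_has_vector_derivative)
  then have "(\<gamma> has_vector_derivative 0) (at z)"
    using \<gamma>_eq by simp
  then show False
    using vector_derivative_unique_at[OF deriv[of z]] regular[of z] by blast
qed

definition normal_part :: "real \<Rightarrow> 'a \<Rightarrow> 'a" where
  "normal_part s x = (x - \<gamma> s) - ((x - \<gamma> s) \<bullet> tangent s) *\<^sub>R tangent s"

lemma normal_part_tangent: "normal_part s x \<bullet> tangent s = 0"
proof -
  have "tangent s \<bullet> tangent s = 1" by (simp add: dot_square_norm norm_tangent)
  then show ?thesis by (simp add: normal_part_def inner_diff_left)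
qed

end

text \<open>
  The assumption is what equality in the energy estimate leaves to be exploited, see \<open>turning_eq_pi\<close>:
  seen from any point of the curve, the directions run along a geodesic from \<open>tangent s\<close> to its antipode.
\<close>

locale tight_closed_curve = holder_closed_curve +
  assumes tight: "s < t \<Longrightarrow> t \<le> u \<Longrightarrow> u < s + 1 \<Longrightarrow> turning s t u = pi"
begin

lemma angle_additive:
  assumes "s < t" "t \<le> u" "u < s + 1"
  shows "angle (tangent s) (dir s u) = angle (tangent s) (dir s t) + angle (dir s t) (dir s u)"
proof -
  have "angle (dir s u) (- tangent s) = pi - angle (dir s u) (tangent s)"
    using assms by (intro angle_minus_right norm_dir norm_tangent) auto
  then show ?thesis
    using tight[OF assms] unfolding turning_def angle_commute[of "dir s u" "tangent s"] by linarith
qed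

lemma tangent_inner_dir_antimono:
  assumes "s < t" "t \<le> u" "u < s + 1"
  shows "tangent s \<bullet> dir s u \<le> tangent s \<bullet> dir s t"
proof -
  have n: "norm (tangent s) = 1" "norm (dir s t) = 1" "norm (dir s u) = 1"
    using assms by (auto simp: norm_dir norm_tangent)
  have "angle (tangent s) (dir s t) \<le> angle (tangent s) (dir s u)"
    using angle_additive[OF assms] angle_bounds(1)[OF n(2,3)] by simp
  then have "cos (angle (tangent s) (dir s u)) \<le> cos (angle (tangent s) (dir s t))"
    using angle_bounds[OF n(1,2)] angle_bounds[OF n(1,3)] by (intro cos_monotone_0_pi_le) auto
  then show ?thesis using angle_bounds(3)[OF n(1,2)] angle_bounds(3)[OF n(1,3)] by simp
qed

text \<open>
  All half great circles between antipodal points are determined by the direction in which they start,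
  and by \<open>angle_additive_perp\<close> this direction is the same for all points of the curve.
\<close>

lemma normal_parts_aligned:
  assumes "x \<in> range \<gamma>" "y \<in> range \<gamma>"
  shows "norm (normal_part s x) *\<^sub>R normal_part s y = norm (normal_part s y) *\<^sub>R normal_part s x"
proof -
  have scale: "normal_part s (\<gamma> v) = norm (\<gamma> v - \<gamma> s) *\<^sub>R (dir s v - (dir s v \<bullet> tangent s) *\<^sub>R tangent s)"
    if "s < v" "v < s + 1" for v
  proof -
    have w: "\<gamma> v - \<gamma> s = norm (\<gamma> v - \<gamma> s) *\<^sub>R dir s v"
      using curve_neq[OF that] by (simp add: dir_def sgn_div_norm)
    show ?thesis
      unfolding normal_part_def by (subst (1 2) w) (simp add: scaleR_diff_right)
  qed
  have ordered: "normal_part s (\<gamma> t) \<bullet> normal_part s (\<gamma> u) = norm (normal_part s (\<gamma> t)) * norm (normal_part s (\<gamma> u))"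
    if "s < t" "t \<le> u" "u < s + 1" for t u
    using angle_additive_perp[OF norm_tangent norm_dir norm_dir angle_additive[OF that]] that
    by (simp add: scale)
  obtain t u where tu: "x = \<gamma> t" "y = \<gamma> u" "t \<in> {s..<s + 1}" "u \<in> {s..<s + 1}"
    using assms unfolding range_curve[of s] by auto
  have zero: "normal_part s (\<gamma> s) = 0" by (simp add: normal_part_def)
  have "normal_part s x \<bullet> normal_part s y = norm (normal_part s x) * norm (normal_part s y)"
  proof (cases "t = s \<or> u = s")
    case True
    then show ?thesis using tu zero by auto
  next
    case False
    then have "s < t" "s < u" using tu by auto
    then show ?thesis
      using ordered[of t u] ordered[of u t] tu by (cases "t \<le> u") (auto simp: inner_commute mult.commute)
  qed
  then show ?thesis by (simp add: norm_cauchy_schwarz_eq)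
qed

text \<open>
  Seen from \<open>\<gamma> s\<close>, the curve lies in the half-plane that is bounded by the tangent line and contains \<open>e\<close>.
  Some point \<open>p\<close> lies off the tangent line because the curve is not collinear.
\<close>

lemma half_plane:
  obtains e p where "norm e = 1" "e \<bullet> tangent s = 0" "p \<in> range \<gamma>" "normal_part s p \<noteq> 0"
    and "\<And>x. x \<in> range \<gamma> \<Longrightarrow> normal_part s x = norm (normal_part s x) *\<^sub>R e"
proof -
  have "\<exists>p\<in>range \<gamma>. normal_part s p \<noteq> 0"
  proof (rule ccontr)
    assume "\<not> ?thesis"
    then have *: "x - \<gamma> s = ((x - \<gamma> s) \<bullet> tangent s) *\<^sub>R tangent s" if "x \<in> range \<gamma>" for x
      using that by (auto simp: normal_part_def)
    have "x - y = (((x - \<gamma> s) \<bullet> tangent s) - ((y - \<gamma> s) \<bullet> tangent s)) *\<^sub>R tangent s"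
      if "x \<in> range \<gamma>" "y \<in> range \<gamma>" for x y
    proof -
      have "x - y = (x - \<gamma> s) - (y - \<gamma> s)" by simp
      also have "\<dots> = ((x - \<gamma> s) \<bullet> tangent s) *\<^sub>R tangent s - ((y - \<gamma> s) \<bullet> tangent s) *\<^sub>R tangent s"
        using *[OF that(1)] *[OF that(2)] by simp
      finally show ?thesis by (simp only: scaleR_diff_left)
    qed
    then have "collinear (range \<gamma>)" unfolding collinear_def by blast
    with not_collinear show False by simp
  qed
  then obtain p where p: "p \<in> range \<gamma>" "normal_part s p \<noteq> 0" by blast
  show ?thesis
  proof
    show "norm (sgn (normal_part s p)) = 1" using p by (simp add: norm_sgn)
    show "sgn (normal_part s p) \<bullet> tangent s = 0" by (simp add: sgn_div_norm normal_part_tangent)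
    show "normal_part s x = norm (normal_part s x) *\<^sub>R sgn (normal_part s p)" if "x \<in> range \<gamma>" for x
    proof -
      have "norm (normal_part s p) *\<^sub>R normal_part s x = norm (normal_part s x) *\<^sub>R normal_part s p"
        using normal_parts_aligned[OF p(1) that] .
      then have "inverse (norm (normal_part s p)) *\<^sub>R (norm (normal_part s p) *\<^sub>R normal_part s x) =
          inverse (norm (normal_part s p)) *\<^sub>R (norm (normal_part s x) *\<^sub>R normal_part s p)"
        by simp
      then show ?thesis using p by (simp add: sgn_div_norm mult.commute)
    qed
  qed (use p in auto)
qed

lemma aff_dim_curve: "aff_dim (range \<gamma>) = 2"
proof (rule antisym)
  obtain e p where e: "\<And>x. x \<in> range \<gamma> \<Longrightarrow> normal_part 0 x = norm (normal_part 0 x) *\<^sub>R e"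
    using half_plane[of 0] by metis
  let ?y = "\<gamma> 0" and ?T = "tangent 0"
  have "range \<gamma> \<subseteq> affine hull {?y, ?y + ?T, ?y + e}"
  proof
    fix x assume x: "x \<in> range \<gamma>"
    define a where "a = (x - ?y) \<bullet> ?T"
    define b where "b = norm (normal_part 0 x)"
    have "x - ?y - a *\<^sub>R ?T = b *\<^sub>R e"
      using e[OF x] by (simp add: normal_part_def a_def b_def)
    then have "x = (1 - a - b) *\<^sub>R ?y + a *\<^sub>R (?y + ?T) + b *\<^sub>R (?y + e)"
      by (simp add: algebra_simps)
    moreover have "(1 - a - b) + a + b = 1" by simp
    ultimately show "x \<in> affine hull {?y, ?y + ?T, ?y + e}" unfolding affine_hull_3 by blast
  qed
  then have "aff_dim (range \<gamma>) \<le> aff_dim {?y, ?y + ?T, ?y + e}"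
    by (metis aff_dim_affine_hull aff_dim_subset)
  also have "\<dots> \<le> of_nat (card {?y, ?y + ?T, ?y + e}) - 1" by (intro aff_dim_le_card) auto
  also have "card {?y, ?y + ?T, ?y + e} \<le> 3" by (simp add: card_insert_if)
  finally show "aff_dim (range \<gamma>) \<le> 2" by simp
  show "2 \<le> aff_dim (range \<gamma>)" using not_collinear collinear_aff_dim[of "range \<gamma>"] by simp
qed

text \<open>
  The tangent line at \<open>y\<close> supports the convex hull. If \<open>y\<close> were a relative interior point, the segment
  from \<open>p\<close> to \<open>y\<close> could be prolonged beyond \<open>y\<close> within the hull, to the wrong side of that line.
\<close>

lemma curve_subset_rel_frontier: "range \<gamma> \<subseteq> rel_frontier (convex hull range \<gamma>)"
proof
  let ?K = "convex hull range \<gamma>"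
  fix y assume y: "y \<in> range \<gamma>"
  then obtain s where s: "y = \<gamma> s" by auto
  obtain e p where e: "norm e = 1" "e \<bullet> tangent s = 0" and p: "p \<in> range \<gamma>" "normal_part s p \<noteq> 0"
    and al: "\<And>x. x \<in> range \<gamma> \<Longrightarrow> normal_part s x = norm (normal_part s x) *\<^sub>R e"
    by (rule half_plane[of s]) blast
  have height: "e \<bullet> (x - y) = norm (normal_part s x)" if "x \<in> range \<gamma>" for x
  proof -
    have "e \<bullet> (x - y) = e \<bullet> normal_part s x" using e(2) by (simp add: normal_part_def s inner_diff_right)
    also have "\<dots> = e \<bullet> (norm (normal_part s x) *\<^sub>R e)" using al[OF that] by simp
    also have "\<dots> = norm (normal_part s x)" using e(1) by (simp add: dot_square_norm)
    finally show ?thesis .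
  qed
  have "?K \<subseteq> {x. e \<bullet> x \<ge> e \<bullet> y}"
  proof (rule hull_minimal)
    show "range \<gamma> \<subseteq> {x. e \<bullet> x \<ge> e \<bullet> y}"
    proof
      fix x assume "x \<in> range \<gamma>"
      then have "e \<bullet> (x - y) \<ge> 0" using height by simp
      then show "x \<in> {x. e \<bullet> x \<ge> e \<bullet> y}" by (simp add: inner_diff_right)
    qed
  qed (rule convex_halfspace_ge)
  then have above: "e \<bullet> y \<le> e \<bullet> x" if "x \<in> ?K" for x using that by blast
  have "y \<notin> rel_interior ?K"
  proof
    assume "y \<in> rel_interior ?K"
    then obtain c where c: "c > 1" "(1 - c) *\<^sub>R p + c *\<^sub>R y \<in> ?K"
      using p(1) hull_inc[of p "range \<gamma>" convex] by (subst (asm) convex_rel_interior_iff) auto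
    have "e \<bullet> ((1 - c) *\<^sub>R p + c *\<^sub>R y) = e \<bullet> y + (1 - c) * (e \<bullet> (p - y))"
      by (simp add: inner_add_right inner_diff_right algebra_simps)
    moreover have "(1 - c) * (e \<bullet> (p - y)) < 0"
      using c(1) p by (simp add: height mult_neg_pos)
    ultimately show False using above[OF c(2)] by simp
  qed
  then show "y \<in> rel_frontier ?K"
    using y closure_subset[of ?K] hull_inc[of y "range \<gamma>" convex] by (auto simp: rel_frontier_def)
qed

text \<open>
  If \<open>\<gamma> t\<close> lies on the tangent line at \<open>\<gamma> s\<close>, then \<open>dir s t\<close> is an endpoint \<open>\<plusminus> tangent s\<close> of the half
  great circle. By monotonicity the direction then equals \<open>tangent s\<close> until the time \<open>t\<close>, or
  \<open>- tangent s\<close> from the time \<open>t\<close> on. In either case an arc joining \<open>\<gamma> s\<close> and \<open>\<gamma> t\<close> stays on a ray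
  from \<open>\<gamma> s\<close>, and by the intermediate value theorem it covers the segment.
\<close>

lemma tangential_chord_subset:
  assumes st: "s < t" "t < s + 1" and flat: "normal_part s (\<gamma> t) = 0"
  shows "closed_segment (\<gamma> s) (\<gamma> t) \<subseteq> range \<gamma>"
proof
  fix z assume "z \<in> closed_segment (\<gamma> s) (\<gamma> t)"
  then obtain \<mu> where \<mu>: "0 \<le> \<mu>" "\<mu> \<le> 1" "z = \<gamma> s + \<mu> *\<^sub>R (\<gamma> t - \<gamma> s)"
    by (auto simp: closed_segment_def algebra_simps)
  define a where "a = (\<gamma> t - \<gamma> s) \<bullet> tangent s"
  have chord: "\<gamma> t - \<gamma> s = a *\<^sub>R tangent s"
    using flat by (simp add: normal_part_def a_def)
  have TT: "tangent s \<bullet> tangent s = 1" by (simp add: dot_square_norm norm_tangent)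
  have "a \<noteq> 0" using chord curve_neq[OF st] by auto
  have dir_t: "dir s t = sgn a *\<^sub>R tangent s"
    unfolding dir_def chord sgn_scaleR by (simp add: sgn_div_norm[of "tangent s"] norm_tangent)
  have cont: "continuous_on A (\<lambda>v. norm (\<gamma> v - \<gamma> s))" for A
    by (intro continuous_intros continuous_on_curve)
  have unit: "dir s v \<bullet> dir s v = 1" if "s < v" "v < s + 1" for v
    using norm_dir[OF that] by (simp add: dot_square_norm)
  have len: "norm (\<gamma> t - \<gamma> s) = \<bar>a\<bar>" by (simp add: chord norm_tangent)
  \<comment> \<open>it suffices to find a point in the right direction at the right distance\<close>
  have goal: "z \<in> range \<gamma>" if v: "s \<le> v" "v \<le> s + 1" and n: "norm (\<gamma> v - \<gamma> s) = \<mu> * \<bar>a\<bar>"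
    and straight: "s < v \<Longrightarrow> v < s + 1 \<Longrightarrow> dir s v = sgn a *\<^sub>R tangent s" for v
  proof (cases "\<gamma> v = \<gamma> s")
    case True
    then show ?thesis using n \<open>a \<noteq> 0\<close> \<mu> by auto
  next
    case False
    then have "s < v" "v < s + 1" using v periodic[of s] by (auto simp: order_le_less)
    then have straight': "dir s v = sgn a *\<^sub>R tangent s" by (rule straight)
    have "\<gamma> v - \<gamma> s = norm (\<gamma> v - \<gamma> s) *\<^sub>R dir s v"
      using False by (simp add: dir_def sgn_div_norm)
    also have "\<dots> = norm (\<gamma> v - \<gamma> s) *\<^sub>R (sgn a *\<^sub>R tangent s)" by (simp only: straight')
    also have "\<dots> = \<mu> *\<^sub>R ((\<bar>a\<bar> * sgn a) *\<^sub>R tangent s)" by (simp only: n scaleR_scaleR mult.assoc)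
    also have "\<dots> = \<mu> *\<^sub>R (\<gamma> t - \<gamma> s)" by (simp add: chord abs_mult_sgn)
    finally have "z = \<gamma> v" using \<mu>(3) by (metis add.commute diff_add_cancel)
    then show ?thesis by simp
  qed
  show "z \<in> range \<gamma>"
  proof (cases "a > 0")
    case True
    have "\<exists>v\<ge>s. v \<le> t \<and> norm (\<gamma> v - \<gamma> s) = \<mu> * \<bar>a\<bar>"
      using \<mu> st len by (intro IVT' cont) (auto intro: mult_left_le_one_le)
    then obtain v where v: "s \<le> v" "v \<le> t" "norm (\<gamma> v - \<gamma> s) = \<mu> * \<bar>a\<bar>" by blast
    show ?thesis
    proof (rule goal)
      assume v': "s < v" "v < s + 1"
      have "tangent s \<bullet> dir s v \<ge> 1"
        using tangent_inner_dir_antimono[of s v t] v v' st dir_t True TT by simp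
      then have "(norm (tangent s - dir s v))\<^sup>2 \<le> 0"
        using TT unit[OF v'] unfolding power2_norm_eq_inner
        by (simp add: inner_diff_left inner_diff_right inner_commute)
      then show "dir s v = sgn a *\<^sub>R tangent s" using True by simp
    qed (use v st in auto)
  next
    case False
    then have neg: "a < 0" using \<open>a \<noteq> 0\<close> by simp
    have "\<exists>v\<ge>t. v \<le> s + 1 \<and> norm (\<gamma> v - \<gamma> s) = \<mu> * \<bar>a\<bar>"
      using \<mu> st len periodic[of s] by (intro IVT2' cont) (auto intro: mult_left_le_one_le)
    then obtain v where v: "t \<le> v" "v \<le> s + 1" "norm (\<gamma> v - \<gamma> s) = \<mu> * \<bar>a\<bar>" by blast
    show ?thesis
    proof (rule goal)
      assume v': "s < v" "v < s + 1"
      have "tangent s \<bullet> dir s v \<le> - 1"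
        using tangent_inner_dir_antimono[of s t v] v v' st dir_t neg TT by simp
      then have "(norm (tangent s + dir s v))\<^sup>2 \<le> 0"
        using TT unit[OF v'] unfolding power2_norm_eq_inner
        by (simp add: inner_add_left inner_add_right inner_commute)
      then have "tangent s + dir s v = 0" by simp
      then show "dir s v = sgn a *\<^sub>R tangent s" using neg by (simp add: add_eq_0_iff)
    qed (use v st in auto)
  qed
qed

text \<open>
  A supporting hyperplane of the convex hull at \<open>z\<close> cuts out a face \<open>F\<close> of dimension at most one, spanned
  by points of the curve, so that by Caratheodory's theorem \<open>z\<close> lies on a segment between two points \<open>p\<close>
  and \<open>q\<close> of the curve. The hyperplane also contains the tangent line at \<open>p\<close>, and in the plane of the curve
  it contains nothing else. Hence \<open>q\<close> lies on that tangent line, and \<open>tangential_chord_subset\<close> applies.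
\<close>

lemma rel_frontier_subset_curve: "rel_frontier (convex hull range \<gamma>) \<subseteq> range \<gamma>"
proof
  let ?K = "convex hull range \<gamma>"
  fix z assume z: "z \<in> rel_frontier ?K"
  have K: "compact ?K" "convex ?K" using compact_curve by (auto intro: compact_convex_hull)
  have zK: "z \<in> ?K" "z \<notin> rel_interior ?K"
    using z closure_closed[OF compact_imp_closed[OF K(1)]] by (auto simp: rel_frontier_def)
  obtain n where n: "\<And>x. x \<in> ?K \<Longrightarrow> n \<bullet> z \<le> n \<bullet> x"
    and n_int: "\<And>x. x \<in> rel_interior ?K \<Longrightarrow> n \<bullet> z < n \<bullet> x"
    by (rule supporting_hyperplane_rel_boundary[OF K(2) zK]) (rule that)
  have "rel_interior ?K \<noteq> {}" using rel_interior_eq_empty[OF K(2)] zK(1) by auto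
  then obtain w where w: "w \<in> ?K" "n \<bullet> z < n \<bullet> w"
    using n_int rel_interior_subset[of ?K] by blast
  define F where "F = ?K \<inter> {x. n \<bullet> x = n \<bullet> z}"
  have face: "F face_of ?K"
    unfolding F_def using K n by (intro face_of_Int_supporting_hyperplane_ge) auto
  have "w \<notin> F" using w by (simp add: F_def)
  then have "F \<noteq> ?K" using w(1) by metis
  then have dimF: "aff_dim F < 2"
    using face_of_aff_dim_lt[OF K(2) face] aff_dim_convex_hull[of "range \<gamma>"] aff_dim_curve by simp
  obtain S where S: "S \<subseteq> range \<gamma>" "F = convex hull S"
    using face_of_convex_hull_subset[OF compact_curve face] by blast
  have "z \<in> convex hull S" using zK(1) S by (auto simp: F_def)
  then obtain B where B: "finite B" "B \<subseteq> S" "int (card B) \<le> aff_dim S + 1" "z \<in> convex hull B"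
    unfolding caratheodory_aff_dim[of S] by blast
  have "aff_dim S < 2" using dimF S(2) by (simp add: aff_dim_convex_hull)
  then have "card B \<le> 2" using B(3) by simp
  moreover have "B \<noteq> {}" using B(4) by auto
  ultimately obtain p q where pq: "B = {p, q}"
    using B(1) by (metis card_0_eq card_1_singletonE card_2_iff insert_absorb2 le_Suc_eq le_zero_eq numeral_2_eq_2 One_nat_def)
  then have seg: "z \<in> closed_segment p q" using B(4) by (simp add: segment_convex_hull)
  have pq_in: "p \<in> range \<gamma>" "q \<in> range \<gamma>" and "p \<in> F" "q \<in> F"
    using pq B(2) S hull_subset[of S convex] by auto
  then have pq_n: "n \<bullet> p = n \<bullet> z" "n \<bullet> q = n \<bullet> z" by (auto simp: F_def)
  obtain s where s: "p = \<gamma> s" using pq_in by auto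
  obtain t where t: "q = \<gamma> t" "s \<le> t" "t < s + 1" using pq_in(2) range_curve[of s] by auto
  show "z \<in> range \<gamma>"
  proof (cases "t = s")
    case True
    then show ?thesis using seg s t pq_in by simp
  next
    case False
    have min: "n \<bullet> \<gamma> s \<le> n \<bullet> \<gamma> v" for v
      using n[of "\<gamma> v"] hull_inc[of "\<gamma> v" "range \<gamma>" convex] pq_n s by simp
    have "((\<lambda>v. n \<bullet> \<gamma> v) has_real_derivative n \<bullet> \<gamma>' s) (at s)"
      unfolding has_real_derivative_iff_has_vector_derivative
      by (rule bounded_linear.has_vector_derivative[OF bounded_linear_inner_right deriv])
    then have "n \<bullet> \<gamma>' s = 0"
      by (rule DERIV_local_min[where d = 1]) (use min in auto)
    then have nT: "n \<bullet> tangent s = 0" by (simp add: tangent_def sgn_div_norm)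
    then have n_normal: "n \<bullet> normal_part s x = n \<bullet> (x - p)" for x
      by (simp add: normal_part_def s inner_diff_right)
    obtain e where e: "\<And>x. x \<in> range \<gamma> \<Longrightarrow> normal_part s x = norm (normal_part s x) *\<^sub>R e"
      using half_plane[of s] by metis
    \<comment> \<open>otherwise \<open>n\<close> would be constant on the curve and hence on its convex hull\<close>
    have "n \<bullet> e \<noteq> 0"
    proof
      assume ne: "n \<bullet> e = 0"
      have "range \<gamma> \<subseteq> {x. n \<bullet> x = n \<bullet> p}"
      proof
        fix x assume "x \<in> range \<gamma>"
        then have "n \<bullet> (x - p) = norm (normal_part s x) * (n \<bullet> e)"
          using e[of x] n_normal[of x] by (metis inner_scaleR_right)
        then show "x \<in> {x. n \<bullet> x = n \<bullet> p}" using ne by (simp add: inner_diff_right)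
      qed
      then have "?K \<subseteq> {x. n \<bullet> x = n \<bullet> p}" by (rule hull_minimal) (rule convex_hyperplane)
      then show False using w pq_n by auto
    qed
    moreover have "norm (normal_part s q) * (n \<bullet> e) = 0"
      using e[OF pq_in(2)] n_normal[of q] pq_n by (metis diff_self inner_diff_right inner_scaleR_right)
    ultimately have "normal_part s (\<gamma> t) = 0" using t(1) by simp
    with t False have "closed_segment p q \<subseteq> range \<gamma>"
      unfolding s by (simp add: tangential_chord_subset)
    then show ?thesis using seg by blast
  qed
qed

lemma planar_convex: "planar_convex_curve (range \<gamma>)"
  unfolding planar_convex_curve_def
proof (intro exI[of _ "convex hull range \<gamma>"] conjI)
  show "compact (convex hull range \<gamma>)" by (intro compact_convex_hull compact_curve)
  show "aff_dim (convex hull range \<gamma>) = 2" by (simp add: aff_dim_convex_hull aff_dim_curve)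
  show "range \<gamma> = rel_frontier (convex hull range \<gamma>)"
    by (intro antisym curve_subset_rel_frontier rel_frontier_subset_curve)
qed (rule convex_convex_hull)

end

theorem proposition5p10:
  fixes \<Gamma> :: "(real ^ 3) set" and \<alpha> :: real
  assumes "0 < \<alpha>" and "\<alpha> < 1"
    and "C1_holder_closed_curve \<alpha> \<Gamma>"
  shows "ennreal (2 * pi) * emeasure hausdorff1 \<Gamma> \<le> tangent_point_energy \<Gamma>
    \<and> (ennreal (2 * pi) * emeasure hausdorff1 \<Gamma> = tangent_point_energy \<Gamma> \<longrightarrow> planar_convex_curve \<Gamma>)"
proof -
  obtain \<gamma> \<gamma>' where param: "C1_holder_closed_param \<alpha> \<gamma> \<gamma>'" and \<Gamma>: "\<Gamma> = range \<gamma>"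
    using assms(3) by (auto simp: C1_holder_closed_curve_def)
  interpret holder_closed_curve \<alpha> \<gamma> \<gamma>'
    by unfold_locales (use assms(1) param in auto)
  show ?thesis
    unfolding \<Gamma>
  proof (intro conjI impI)
    show "ennreal (2 * pi) * emeasure hausdorff1 (range \<gamma>) \<le> tangent_point_energy (range \<gamma>)"
      by (rule energy_ge)
    assume "ennreal (2 * pi) * emeasure hausdorff1 (range \<gamma>) = tangent_point_energy (range \<gamma>)"
    then interpret tight_closed_curve \<alpha> \<gamma> \<gamma>'
      by unfold_locales (rule turning_eq_pi)
    show "planar_convex_curve (range \<gamma>)" by (rule planar_convex)
  qed
qed

end
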